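(* Suppose that $f(\cdot;\xi)$ is convex and $L$-smooth for every realization of $\xi$ (with $L>0$), that $F$ is $\mu$-strongly convex with $\mu>0$, with minimizer $w_*$, and that there is $\sigma_*>0$ with $\mathbb{E}[\|\nabla f(w_*;\xi)\|^2]\le\sigma_*^2$. Let $\kappa=L/\mu$. Consider iSARAH started at $\tilde w_0\in\mathbb{R}^d$ with $0<\eta\le 1/L$, $m$ and $b$ chosen such that $$\alpha=\frac{1}{\mu\eta(m+1)}+\frac{\eta L}{2-\eta L}+\frac{4\kappa-2}{b(2-\eta L)}<1.$$ Then, for every outer iteration $s$, $$\mathbb{E}[\|\nabla F(\tilde w_s)\|^2]-\Delta\le\alpha^s\left(\|\nabla F(\tilde w_0)\|^2-\Delta\right),$$ where $$\Delta=\frac{\delta}{1-\alpha}\quad\text{and}\quad\delta=\frac{4}{b(2-\eta L)}\sigma_*^2.$$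
   Context: $\xi$ is a random variable; for each realization, $f(\cdot;\xi):\mathbb{R}^d\to\mathbb{R}$ is differentiable; $F(w)=\mathbb{E}[f(w;\xi)]$ is bounded below, and $\mathbb{E}[\nabla f(w;\xi)]=\nabla F(w)$ for every fixed $w\in\mathbb{R}^d$. $\|\cdot\|$ is the Euclidean norm. $L$-smooth for every realization means $\|\nabla f(w;\xi)-\nabla f(w';\xi)\|\le L\|w-w'\|$ for all $w,w'\in\mathbb{R}^d$ and every realization of $\xi$. $\mu$-strong convexity of $F$ means $F(w)\ge F(w')+\nabla F(w')^T(w-w')+\frac{\mu}{2}\|w-w'\|^2$ for all $w,w'$. The procedure iSARAH-IN$(w_0,\eta,m,b)$ has parameters $\eta>0$ and positive integers $m,b$. Let $\zeta_1,\dots,\zeta_b,\xi_1,\xi_2,\dots$ be i.i.d. copies of $\xi$, independent of $w_0$. Set $$v_0=\frac1b\sum_{i=1}^b\nabla f(w_0;\zeta_i),\qquad w_1=w_0-\eta v_0,$$ and for $t\ge 1$ $$v_t=\nabla f(w_t;\xi_t)-\nabla f(w_{t-1};\xi_t)+v_{t-1},\qquad w_{t+1}=w_t-\eta v_t.$$ The output is $\tilde w=w_t$ with $t$ chosen uniformly at random from $\{0,1,\dots,m\}$, independently of everything else. iSARAH with parameters $\eta,m,b$ and a given (deterministic) starting point $\tilde w_0$ produces outer iterates $\tilde w_s=\text{iSARAH-IN}(\tilde w_{s-1},\eta,m,b)$ for $s=1,2,\dots$, using fresh independent randomness in each call. *)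

theory Defs
  imports "HOL-Probability.Probability"
begin

definition grad :: "('a::real_inner \<Rightarrow> real) \<Rightarrow> 'a \<Rightarrow> 'a" where
  "grad h w = (THE D. GDERIV h w :> D)"

lemma grad_eqI:
  assumes "GDERIV h w :> D"
  shows "grad h w = D"
  unfolding grad_def
proof (rule the_equality)
  fix D' assume "GDERIV h w :> D'"
  with assms have "(\<lambda>v. inner v D') = (\<lambda>v. inner v D)"
    unfolding gderiv_def by (blast intro: has_derivative_unique)
  then have "inner v D' = inner v D" for v
    by meson
  then have "inner (D' - D) (D' - D) = 0"
    by (simp add: inner_diff_right)
  then show "D' = D" by simp
qed (fact assms)

lemma differentiable_grad:
  fixes h :: "'a::euclidean_space \<Rightarrow> real"
  assumes "h differentiable at w"
  shows "GDERIV h w :> grad h w"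
proof -
  from assms obtain h' where h': "(h has_derivative h') (at w)"
    unfolding differentiable_def by blast
  interpret linear h' using h' by (rule has_derivative_linear)
  have "h' v = inner v (\<Sum>b\<in>Basis. h' b *\<^sub>R b)" for v
  proof -
    have "h' v = h' (\<Sum>b\<in>Basis. inner v b *\<^sub>R b)"
      by (simp add: euclidean_representation)
    also have "\<dots> = (\<Sum>b\<in>Basis. inner v b * h' b)"
      by (simp add: sum scale)
    also have "\<dots> = inner v (\<Sum>b\<in>Basis. h' b *\<^sub>R b)"
      by (simp add: inner_sum_right mult.commute)
    finally show ?thesis .
  qed
  then have "h' = (\<lambda>v. inner v (\<Sum>b\<in>Basis. h' b *\<^sub>R b))"
    by (rule ext)
  with h' have "GDERIV h w :> (\<Sum>b\<in>Basis. h' b *\<^sub>R b)"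
    unfolding gderiv_def by metis
  then show ?thesis using grad_eqI by metis
qed

definition L_smooth :: "real \<Rightarrow> ('a::real_inner \<Rightarrow> real) \<Rightarrow> bool" where
  "L_smooth L h \<longleftrightarrow> (\<forall>w w'. norm (grad h w - grad h w') \<le> L * norm (w - w'))"

definition strongly_convex :: "real \<Rightarrow> ('a::real_inner \<Rightarrow> real) \<Rightarrow> bool" where
  "strongly_convex \<mu> h \<longleftrightarrow>
    (\<forall>w w'. h w \<ge> h w' + inner (grad h w') (w - w') + \<mu> / 2 * (norm (w - w'))\<^sup>2)"

(* The random variable xi is represented by its law M, so that its realizations are the points of
   space M; f w x stands for f(w; x). *)

definition expected_loss :: "'x measure \<Rightarrow> ('a \<Rightarrow> 'x \<Rightarrow> real) \<Rightarrow> 'a \<Rightarrow> real" where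
  "expected_loss M f w = (\<integral>x. f w x \<partial>M)"

definition sgrad :: "('a::real_inner \<Rightarrow> 'x \<Rightarrow> real) \<Rightarrow> 'a \<Rightarrow> 'x \<Rightarrow> 'a" where
  "sgrad f w x = grad (\<lambda>u. f u x) w"

(* One inner call for fixed values z 1, ..., z b and x 1, x 2, ... of the samples;
   isarah_in_iter ... t is the pair (w_t, v_t). *)
primrec isarah_in_iter ::
  "('a::real_inner \<Rightarrow> 'x \<Rightarrow> real) \<Rightarrow> real \<Rightarrow> nat \<Rightarrow> 'a \<Rightarrow> (nat \<Rightarrow> 'x) \<Rightarrow> (nat \<Rightarrow> 'x) \<Rightarrow> nat \<Rightarrow> 'a \<times> 'a"
where
  "isarah_in_iter f \<eta> b w0 z x 0 = (w0, (1 / real b) *\<^sub>R (\<Sum>i=1..b. sgrad f w0 (z i)))"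
| "isarah_in_iter f \<eta> b w0 z x (Suc t) =
    (let (w, v) = isarah_in_iter f \<eta> b w0 z x t;
         w' = w - \<eta> *\<^sub>R v
     in (w', sgrad f w' (x (Suc t)) - sgrad f w (x (Suc t)) + v))"

(* zeta s i, xi s t and T s are the initial samples, the step samples and the random output index
   used in the s-th call (s = 1, 2, ...). *)
primrec isarah ::
  "('a::real_inner \<Rightarrow> 'x \<Rightarrow> real) \<Rightarrow> real \<Rightarrow> nat \<Rightarrow> 'a
    \<Rightarrow> (nat \<Rightarrow> nat \<Rightarrow> 'o \<Rightarrow> 'x) \<Rightarrow> (nat \<Rightarrow> nat \<Rightarrow> 'o \<Rightarrow> 'x) \<Rightarrow> (nat \<Rightarrow> 'o \<Rightarrow> nat)
    \<Rightarrow> nat \<Rightarrow> 'o \<Rightarrow> 'a"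
where
  "isarah f \<eta> b w0 \<zeta> \<xi> T 0 \<omega> = w0"
| "isarah f \<eta> b w0 \<zeta> \<xi> T (Suc s) \<omega> =
    fst (isarah_in_iter f \<eta> b (isarah f \<eta> b w0 \<zeta> \<xi> T s \<omega>)
      (\<lambda>i. \<zeta> (Suc s) i \<omega>) (\<lambda>t. \<xi> (Suc s) t \<omega>) (T (Suc s) \<omega>))"

datatype source = Initial nat nat | Step nat nat | Index nat

(* The samples and the indices take values in different spaces, so their joint independence is
   expressed through the sets they generate, exactly as indep_vars does for a common value type. *)
primrec source_events ::
  "'o measure \<Rightarrow> 'x measure \<Rightarrow> (nat \<Rightarrow> nat \<Rightarrow> 'o \<Rightarrow> 'x) \<Rightarrow> (nat \<Rightarrow> nat \<Rightarrow> 'o \<Rightarrow> 'x) \<Rightarrow> (nat \<Rightarrow> 'o \<Rightarrow> nat)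
    \<Rightarrow> source \<Rightarrow> 'o set set"
where
  "source_events P M \<zeta> \<xi> T (Initial s i) = {\<zeta> s i -` A \<inter> space P | A. A \<in> sets M}"
| "source_events P M \<zeta> \<xi> T (Step s t) = {\<xi> s t -` A \<inter> space P | A. A \<in> sets M}"
| "source_events P M \<zeta> \<xi> T (Index s) = {T s -` A \<inter> space P | A. A \<in> sets (count_space UNIV)}"

definition isarah_sampling ::
  "'o measure \<Rightarrow> 'x measure \<Rightarrow> nat \<Rightarrow> nat
    \<Rightarrow> (nat \<Rightarrow> nat \<Rightarrow> 'o \<Rightarrow> 'x) \<Rightarrow> (nat \<Rightarrow> nat \<Rightarrow> 'o \<Rightarrow> 'x) \<Rightarrow> (nat \<Rightarrow> 'o \<Rightarrow> nat) \<Rightarrow> bool"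
where
  "isarah_sampling P M m b \<zeta> \<xi> T \<longleftrightarrow>
    (\<forall>s\<ge>1. \<forall>i\<in>{1..b}. \<zeta> s i \<in> measurable P M \<and> distr P M (\<zeta> s i) = M) \<and>
    (\<forall>s\<ge>1. \<forall>t\<ge>1. \<xi> s t \<in> measurable P M \<and> distr P M (\<xi> s t) = M) \<and>
    (\<forall>s\<ge>1. T s \<in> measurable P (count_space UNIV) \<and>
        distr P (count_space UNIV) (T s) = measure_pmf (pmf_of_set {0..m})) \<and>
    prob_space.indep_sets P (source_events P M \<zeta> \<xi> T)
      ({Initial s i | s i. s \<ge> 1 \<and> i \<in> {1..b}} \<union> {Step s t | s t. s \<ge> 1 \<and> t \<ge> 1} \<union>
       {Index s | s. s \<ge> 1})"

end

theory Submission
  imports Defs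
begin

text \<open>
  Cocoercivity of the stochastic gradients gives, along every realization, that the squared norm of
  \<open>v\<^sub>t\<close> decreases by at least \<open>(2 - \<eta>L)/(\<eta>L)\<close> times the squared norm of the increment
  \<open>v\<^sub>t - v\<^sub>t\<^sub>-\<^sub>1\<close>, so the increments have summable energy bounded by that of \<open>v\<^sub>0\<close>. The
  estimation error \<open>v\<^sub>t - \<nabla>F(w\<^sub>t)\<close> is a martingale whose increments are the centred increments of
  \<open>v\<^sub>t\<close>; hence its second moment exceeds that of the initial mini-batch error by at most
  \<open>\<eta>L/(2 - \<eta>L) E\<parallel>v\<^sub>0\<parallel>\<^sup>2\<close>. Averaging the descent inequality for \<open>F\<close> over \<open>t = 0, \<dots>, m\<close> and
  bounding the mini-batch variance by \<open>(2\<kappa> - 1) \<parallel>\<nabla>F\<parallel>\<^sup>2 + 2\<sigma>\<^sup>2\<close> over \<open>b\<close> yields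
  \<open>E' \<le> \<alpha> E + \<delta>\<close> for the expected squared gradient norm before and after one inner call.
\<close>

section \<open>Smooth and convex functions\<close>

lemma GDERIV_along_line:
  assumes "GDERIV h (w + t *\<^sub>R d) :> D"
  shows "((\<lambda>t. h (w + t *\<^sub>R d)) has_real_derivative inner D d) (at t)"
proof -
  have "((\<lambda>t. w + t *\<^sub>R d) has_derivative (\<lambda>s. s *\<^sub>R d)) (at t)"
    by (auto intro!: derivative_eq_intros)
  from has_derivative_compose[OF this assms[unfolded gderiv_def]]
  show ?thesis
    by (rule has_derivative_imp_has_field_derivative) (simp add: inner_commute)
qed

text \<open>Restriction to the line from \<open>w\<close> to \<open>u\<close> reduces the claim to
  the one-dimensional tangent inequality for a convex function.\<close>

lemma convex_above_gradient:
  fixes h :: "'a::euclidean_space \<Rightarrow> real"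
  assumes "convex_on UNIV h" "h differentiable at w"
  shows "h u \<ge> h w + inner (grad h w) (u - w)"
proof -
  define \<phi> where "\<phi> = (\<lambda>t::real. h (w + t *\<^sub>R (u - w)))"
  have "convex_on UNIV \<phi>"
  proof (rule convex_onI)
    fix t x y :: real assume t: "0 < t" "t < 1"
    have "w + ((1 - t) * x + t * y) *\<^sub>R (u - w) =
        (1 - t) *\<^sub>R (w + x *\<^sub>R (u - w)) + t *\<^sub>R (w + y *\<^sub>R (u - w))"
      by (simp add: algebra_simps)
    then show "\<phi> ((1 - t) *\<^sub>R x + t *\<^sub>R y) \<le> (1 - t) * \<phi> x + t * \<phi> y"
      using convex_onD[OF assms(1), of t] t by (simp add: \<phi>_def)
  qed simp
  moreover have "(\<phi> has_real_derivative inner (grad h w) (u - w)) (at 0 within UNIV)"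
    unfolding \<phi>_def using GDERIV_along_line[of h w 0 "u - w"] differentiable_grad[OF assms(2)] by simp
  ultimately have "\<phi> 1 \<ge> \<phi> 0 + inner (grad h w) (u - w) * (1 - 0)"
    using convex_on_imp_above_tangent[of UNIV \<phi> 0 1 "inner (grad h w) (u - w)"] by simp
  then show ?thesis by (simp add: \<phi>_def)
qed

text \<open>The descent lemma. Along the segment from \<open>w\<close> to \<open>u\<close>,
  \<open>h\<close> minus the claimed upper bound is nonincreasing, because Cauchy-Schwarz and the
  Lipschitz gradient make its derivative nonpositive; no integral of the gradient is
  involved.\<close>

lemma L_smooth_upper_bound:
  fixes h :: "'a::euclidean_space \<Rightarrow> real"
  assumes smooth: "L_smooth L h" and diff: "\<And>w. h differentiable at w"
  shows "h u \<le> h w + inner (grad h w) (u - w) + L / 2 * (norm (u - w))\<^sup>2"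
proof -
  define d where "d = u - w"
  define \<phi> where "\<phi> = (\<lambda>t::real. h (w + t *\<^sub>R d) - t * inner (grad h w) d - L / 2 * t\<^sup>2 * (norm d)\<^sup>2)"
  have "\<phi> 1 \<le> \<phi> 0"
  proof (rule DERIV_nonpos_imp_nonincreasing[of 0 1 \<phi>])
    fix t :: real assume t: "0 \<le> t" "t \<le> 1"
    have "(\<phi> has_real_derivative
        inner (grad h (w + t *\<^sub>R d)) d - inner (grad h w) d - L * t * (norm d)\<^sup>2) (at t)"
      unfolding \<phi>_def
      by (auto intro!: derivative_eq_intros GDERIV_along_line differentiable_grad diff)
    moreover have "inner (grad h (w + t *\<^sub>R d) - grad h w) d \<le> L * norm (t *\<^sub>R d) * norm d"
      using smooth[unfolded L_smooth_def, rule_format, of "w + t *\<^sub>R d" w]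
      by (intro order_trans[OF norm_cauchy_schwarz] mult_right_mono) auto
    ultimately show "\<exists>y. (\<phi> has_real_derivative y) (at t) \<and> y \<le> 0"
      using t by (intro exI[of _ "inner (grad h (w + t *\<^sub>R d)) d - inner (grad h w) d - L * t * (norm d)\<^sup>2"])
        (auto simp: inner_diff_left power2_eq_square mult.assoc)
  qed simp
  then show ?thesis by (simp add: \<phi>_def d_def)
qed

text \<open>Evaluate \<open>h\<close> at \<open>u = w - (1 / L) *\<^sub>R g\<close>, with
  \<open>g\<close> the difference of the two gradients. Convexity bounds \<open>h u\<close> from
  below by the tangent at \<open>w'\<close>, and smoothness bounds it from above around
  \<open>w\<close>; comparing the two leaves the extra term in \<open>g\<close>.\<close>

lemma smooth_convex_lower_bound:
  fixes h :: "'a::euclidean_space \<Rightarrow> real"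
  assumes smooth: "L_smooth L h" and diff: "\<And>w. h differentiable at w"
    and conv: "convex_on UNIV h" and "L > 0"
  shows "h w' + inner (grad h w') (w - w') + (norm (grad h w - grad h w'))\<^sup>2 / (2 * L) \<le> h w"
proof -
  define g where "g = grad h w - grad h w'"
  define u where "u = w - (1 / L) *\<^sub>R g"
  have "h w' + inner (grad h w') (u - w') \<le> h u"
    by (rule convex_above_gradient) (auto simp: conv diff)
  also have "h u \<le> h w + inner (grad h w) (u - w) + L / 2 * (norm (u - w))\<^sup>2"
    by (rule L_smooth_upper_bound[OF smooth diff])
  finally have *: "h w' + inner (grad h w') (u - w') \<le> h w + inner (grad h w) (u - w) + L / 2 * (norm (u - w))\<^sup>2" .
  have "h w' + inner (grad h w') (w - w') \<le>
      h w - (1 / L) * inner g g + L / 2 * (norm ((1 / L) *\<^sub>R g))\<^sup>2"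
  proof -
    have "u - w' = (w - w') - (1 / L) *\<^sub>R g" "u - w = - ((1 / L) *\<^sub>R g)"
      by (simp_all add: u_def)
    with * show ?thesis
      by (simp add: inner_diff_right inner_diff_left[of "grad h w" "grad h w'" g, folded g_def]
          right_diff_distrib del: scaleR_minus_right)
  qed
  also have "L / 2 * (norm ((1 / L) *\<^sub>R g))\<^sup>2 = (norm g)\<^sup>2 / (2 * L)"
    using \<open>L > 0\<close> by (simp add: power_divide power2_eq_square)
  finally show ?thesis
    using \<open>L > 0\<close> by (simp add: g_def[symmetric] power2_norm_eq_inner field_simps)
qed

lemma grad_cocoercive:
  fixes h :: "'a::euclidean_space \<Rightarrow> real"
  assumes smooth: "L_smooth L h" and diff: "\<And>w. h differentiable at w"
    and conv: "convex_on UNIV h" and "L > 0"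
  shows "(norm (grad h w - grad h w'))\<^sup>2 \<le> L * inner (grad h w - grad h w') (w - w')"
proof -
  \<comment> \<open>Adding the lower bound to itself with \<open>w\<close> and \<open>w'\<close>
    exchanged cancels the function values and doubles the quadratic term.\<close>
  have "(norm (grad h w - grad h w'))\<^sup>2 / L \<le> inner (grad h w - grad h w') (w - w')"
    using smooth_convex_lower_bound[OF assms, of w w'] smooth_convex_lower_bound[OF assms, of w' w]
    by (simp add: inner_diff_left inner_diff_right norm_minus_commute)
  then show ?thesis using \<open>L > 0\<close> by (simp add: field_simps)
qed

text \<open>The Polyak-Lojasiewicz inequality: completing the square bounds the quadratic minorant
  of \<open>h\<close> around \<open>w\<close> from below, uniformly in \<open>u\<close>.\<close>

lemma strongly_convex_gap_le:
  fixes h :: "'a::real_inner \<Rightarrow> real"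
  assumes "strongly_convex \<mu> h" "\<mu> > 0"
  shows "h w - h u \<le> (norm (grad h w))\<^sup>2 / (2 * \<mu>)"
proof -
  have "h w + inner (grad h w) (u - w) + \<mu> / 2 * (norm (u - w))\<^sup>2 \<le> h u"
    using assms(1) by (simp add: strongly_convex_def)
  moreover have "0 \<le> (norm (\<mu> *\<^sub>R (u - w) + grad h w))\<^sup>2 / (2 * \<mu>)"
    using \<open>\<mu> > 0\<close> by simp
  then have "0 \<le> \<mu> / 2 * (norm (u - w))\<^sup>2 + inner (grad h w) (u - w) + (norm (grad h w))\<^sup>2 / (2 * \<mu>)"
    using \<open>\<mu> > 0\<close>
    by (simp add: power2_norm_eq_inner inner_add_left inner_add_right inner_commute add_divide_distrib)
  ultimately show ?thesis by simp
qed

lemma grad_at_minimum: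
  fixes h :: "'a::euclidean_space \<Rightarrow> real"
  assumes diff: "h differentiable at w" and min: "\<And>u. h w \<le> h u"
  shows "grad h w = 0"
proof -
  have "(\<lambda>v. inner v (grad h w)) = (\<lambda>v. 0)"
    using differential_zero_maxmin[of w UNIV h] differentiable_grad[OF diff] min
    by (auto simp: gderiv_def)
  then show ?thesis by (metis inner_eq_zero_iff)
qed

lemma L_smooth_imp_continuous_grad:
  fixes h :: "'a::real_inner \<Rightarrow> real"
  assumes "L_smooth L h" "L \<ge> 0"
  shows "continuous_on UNIV (grad h)"
  by (rule lipschitz_on_continuous_on[of L], rule lipschitz_onI)
    (use assms in \<open>auto simp: L_smooth_def dist_norm\<close>)

section \<open>Square integrability and independence\<close>

text \<open>Random points will be substituted for \<open>w\<close>, so measurability for each fixed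
  \<open>w\<close> must become joint measurability. Simple functions approximating the identity
  replace the first argument by countably many values, and continuity passes to the limit.\<close>

lemma borel_measurable_Caratheodory:
  fixes g :: "'a::{metric_space, second_countable_topology} \<Rightarrow> 'x \<Rightarrow> 'b::metric_space"
  assumes cont: "\<And>x. x \<in> space M \<Longrightarrow> continuous_on UNIV (\<lambda>w. g w x)"
    and meas: "\<And>w. g w \<in> borel_measurable M"
  shows "(\<lambda>p. g (fst p) (snd p)) \<in> borel_measurable (borel \<Otimes>\<^sub>M M)"
proof -
  obtain s :: "nat \<Rightarrow> 'a \<Rightarrow> 'a" where s: "\<And>i. simple_function borel (s i)"
    and lim: "\<And>w. (\<lambda>i. s i w) \<longlonglongrightarrow> w"
    using borel_measurable_implies_sequence_metric[of "\<lambda>w::'a. w" borel undefined] by auto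
  show ?thesis
  proof (rule borel_measurable_LIMSEQ_metric)
    fix i
    have "finite (range (s i))"
      using simple_functionD(1)[OF s] by simp
    moreover have "s i -` {a} \<in> sets borel" for a
      using simple_functionD(2)[OF s, of i "{a}"] by simp
    ultimately have "s i \<in> measurable borel (count_space (range (s i)))"
      by (subst measurable_count_space_eq2) auto
    then have "(\<lambda>p. s i (fst p)) \<in> measurable (borel \<Otimes>\<^sub>M M) (count_space (range (s i)))"
      by (rule measurable_compose[OF measurable_fst])
    then show "(\<lambda>p. g (s i (fst p)) (snd p)) \<in> borel_measurable (borel \<Otimes>\<^sub>M M)"
      by (rule measurable_compose_countable'[where f = "\<lambda>v p. g v (snd p)",
            OF measurable_compose[OF measurable_snd meas]])
        (use \<open>finite (range (s i))\<close> in \<open>rule countable_finite\<close>)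
  next
    fix p :: "'a \<times> 'x" assume "p \<in> space (borel \<Otimes>\<^sub>M M)"
    then have "snd p \<in> space M" by (auto simp: space_pair_measure)
    from cont[OF this] have "isCont (\<lambda>w. g w (snd p)) (fst p)"
      by (simp add: continuous_on_eq_continuous_at)
    from isCont_tendsto_compose[OF this lim]
    show "(\<lambda>i. g (s i (fst p)) (snd p)) \<longlonglongrightarrow> g (fst p) (snd p)" .
  qed
qed

section \<open>Square-integrable random vectors\<close>

definition square_integrable :: "'o measure \<Rightarrow> ('o \<Rightarrow> 'a::euclidean_space) \<Rightarrow> bool" where
  "square_integrable P X \<longleftrightarrow> X \<in> borel_measurable P \<and> integrable P (\<lambda>\<omega>. (norm (X \<omega>))\<^sup>2)"

lemma square_integrableD:
  assumes "square_integrable P X"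
  shows "X \<in> borel_measurable P" "integrable P (\<lambda>\<omega>. (norm (X \<omega>))\<^sup>2)"
  using assms by (auto simp: square_integrable_def)

lemma square_integrable_bound:
  assumes "square_integrable P Y" "X \<in> borel_measurable P"
    and "\<And>\<omega>. \<omega> \<in> space P \<Longrightarrow> norm (X \<omega>) \<le> norm (Y \<omega>)"
  shows "square_integrable P X"
proof -
  have "integrable P (\<lambda>\<omega>. (norm (X \<omega>))\<^sup>2)"
  proof (rule Bochner_Integration.integrable_bound)
    show "integrable P (\<lambda>\<omega>. (norm (Y \<omega>))\<^sup>2)"
      using assms(1) by (rule square_integrableD)
    show "(\<lambda>\<omega>. (norm (X \<omega>))\<^sup>2) \<in> borel_measurable P"
      using assms(2) by measurable
    show "AE \<omega> in P. norm ((norm (X \<omega>))\<^sup>2) \<le> norm ((norm (Y \<omega>))\<^sup>2)"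
      using assms(3) by (intro AE_I2) (simp add: power_mono)
  qed
  with assms(2) show ?thesis by (simp add: square_integrable_def)
qed

lemma norm_add_square_le: "(norm (x + y))\<^sup>2 \<le> 2 * (norm x)\<^sup>2 + 2 * (norm (y::'a::real_inner))\<^sup>2"
proof -
  have "0 \<le> (norm (x - y))\<^sup>2" by simp
  then show ?thesis
    by (simp add: power2_norm_eq_inner inner_add_left inner_add_right
        inner_diff_left inner_diff_right inner_commute)
qed

lemma square_integrable_add:
  assumes "square_integrable P X" "square_integrable P Y"
  shows "square_integrable P (\<lambda>\<omega>. X \<omega> + Y \<omega>)"
proof -
  note [measurable] = square_integrableD(1)[OF assms(1)] square_integrableD(1)[OF assms(2)]
  have "integrable P (\<lambda>\<omega>. (norm (X \<omega> + Y \<omega>))\<^sup>2)"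
  proof (rule Bochner_Integration.integrable_bound)
    show "integrable P (\<lambda>\<omega>. 2 * (norm (X \<omega>))\<^sup>2 + 2 * (norm (Y \<omega>))\<^sup>2)"
      using assms by (simp add: square_integrable_def)
    show "AE \<omega> in P. norm ((norm (X \<omega> + Y \<omega>))\<^sup>2) \<le> norm (2 * (norm (X \<omega>))\<^sup>2 + 2 * (norm (Y \<omega>))\<^sup>2)"
      by (simp add: norm_add_square_le)
  qed measurable
  then show ?thesis by (simp add: square_integrable_def)
qed

lemma square_integrable_scaleR:
  assumes "square_integrable P X"
  shows "square_integrable P (\<lambda>\<omega>. c *\<^sub>R X \<omega>)"
  using assms by (auto simp: square_integrable_def power_mult_distrib)

lemma square_integrable_diff:
  assumes "square_integrable P X" "square_integrable P Y"
  shows "square_integrable P (\<lambda>\<omega>. X \<omega> - Y \<omega>)"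
  using square_integrable_add[OF assms(1) square_integrable_scaleR[OF assms(2), of "-1"]] by simp

lemma (in finite_measure) square_integrable_const: "square_integrable M (\<lambda>\<omega>. c)"
  by (simp add: square_integrable_def)

lemma (in finite_measure) square_integrable_sum:
  assumes "\<And>i. i \<in> I \<Longrightarrow> square_integrable M (X i)"
  shows "square_integrable M (\<lambda>\<omega>. \<Sum>i\<in>I. X i \<omega>)"
  using assms
  by (induction I rule: infinite_finite_induct)
    (auto intro: square_integrable_add square_integrable_const)

lemma square_integrable_norm:
  assumes "square_integrable P X"
  shows "square_integrable P (\<lambda>\<omega>. norm (X \<omega>))"
  using assms by (auto simp: square_integrable_def)

lemma square_integrable_inner:
  assumes "square_integrable P X" "square_integrable P Y"
  shows "integrable P (\<lambda>\<omega>. inner (X \<omega>) (Y \<omega>))"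
proof -
  note [measurable] = square_integrableD(1)[OF assms(1)] square_integrableD(1)[OF assms(2)]
  have "inner x y \<le> (norm x)\<^sup>2 + (norm y)\<^sup>2" "- inner x y \<le> (norm x)\<^sup>2 + (norm y)\<^sup>2" for x y :: 'b
  proof -
    have "0 \<le> (norm (x - y))\<^sup>2 + (norm x)\<^sup>2 + (norm y)\<^sup>2" "0 \<le> (norm (x + y))\<^sup>2 + (norm x)\<^sup>2 + (norm y)\<^sup>2"
      by simp_all
    then show "inner x y \<le> (norm x)\<^sup>2 + (norm y)\<^sup>2" "- inner x y \<le> (norm x)\<^sup>2 + (norm y)\<^sup>2"
      by (simp_all add: power2_norm_eq_inner inner_add_left inner_add_right
          inner_diff_left inner_diff_right inner_commute)
  qed
  then have "\<bar>inner x y\<bar> \<le> (norm x)\<^sup>2 + (norm y)\<^sup>2" for x y :: 'b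
    by (simp add: abs_le_iff)
  then have bound: "norm (inner x y) \<le> norm ((norm x)\<^sup>2 + (norm y)\<^sup>2)" for x y :: 'b
    by simp
  show ?thesis
  proof (rule Bochner_Integration.integrable_bound)
    show "integrable P (\<lambda>\<omega>. (norm (X \<omega>))\<^sup>2 + (norm (Y \<omega>))\<^sup>2)"
      using assms by (intro Bochner_Integration.integrable_add square_integrableD)
    show "AE \<omega> in P. norm (inner (X \<omega>) (Y \<omega>)) \<le> norm ((norm (X \<omega>))\<^sup>2 + (norm (Y \<omega>))\<^sup>2)"
      by (intro AE_I2 bound)
  qed measurable
qed

text \<open>Pythagoras in L2. Every variance decomposition below is an instance of it.\<close>

lemma integral_norm_add_orthogonal:
  assumes "square_integrable P X" "square_integrable P Y"
    and "(\<integral>\<omega>. inner (X \<omega>) (Y \<omega>) \<partial>P) = 0"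
  shows "(\<integral>\<omega>. (norm (X \<omega> + Y \<omega>))\<^sup>2 \<partial>P) = (\<integral>\<omega>. (norm (X \<omega>))\<^sup>2 \<partial>P) + (\<integral>\<omega>. (norm (Y \<omega>))\<^sup>2 \<partial>P)"
proof -
  have "(norm (X \<omega> + Y \<omega>))\<^sup>2 = (norm (X \<omega>))\<^sup>2 + (2 * inner (X \<omega>) (Y \<omega>) + (norm (Y \<omega>))\<^sup>2)" for \<omega>
    by (simp add: power2_norm_eq_inner inner_add_left inner_add_right inner_commute)
  then show ?thesis
    using assms(3) square_integrableD(2)[OF assms(1)] square_integrableD(2)[OF assms(2)]
      square_integrable_inner[OF assms(1,2)]
    by simp
qed

text \<open>The library's \<^const>\<open>prob_space.indep_var\<close> forces both variables to have the same value type.\<close>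

definition (in prob_space) indep_pair ::
  "'b measure \<Rightarrow> ('a \<Rightarrow> 'b) \<Rightarrow> 'c measure \<Rightarrow> ('a \<Rightarrow> 'c) \<Rightarrow> bool"
where
  "indep_pair N1 X N2 V \<longleftrightarrow> X \<in> measurable M N1 \<and> V \<in> measurable M N2 \<and>
    (\<forall>A\<in>sets N1. \<forall>B\<in>sets N2. prob ((X -` A \<inter> space M) \<inter> (V -` B \<inter> space M)) =
      prob (X -` A \<inter> space M) * prob (V -` B \<inter> space M))"

lemma (in prob_space) indep_pair_compose:
  assumes indep: "indep_pair N1 X N2 V" and g: "g \<in> measurable N1 N3"
  shows "indep_pair N3 (\<lambda>\<omega>. g (X \<omega>)) N2 V"
proof -
  have X: "X \<in> measurable M N1" using indep by (simp add: indep_pair_def)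
  have "(\<lambda>\<omega>. g (X \<omega>)) -` A \<inter> space M = X -` (g -` A \<inter> space N1) \<inter> space M" for A
    using measurable_space[OF X] by auto
  then show ?thesis
    using indep measurable_sets[OF g] measurable_compose[OF X g]
    unfolding indep_pair_def by metis
qed

text \<open>Independence gives the product formula on measurable rectangles, which determines the
  joint law.\<close>

lemma (in prob_space) distr_indep_pair:
  assumes indep: "indep_pair N1 X N2 V"
  shows "distr M N1 X \<Otimes>\<^sub>M distr M N2 V = distr M (N1 \<Otimes>\<^sub>M N2) (\<lambda>\<omega>. (X \<omega>, V \<omega>))"
proof -
  have X[measurable]: "X \<in> measurable M N1" and V[measurable]: "V \<in> measurable M N2"
    using indep by (auto simp: indep_pair_def)
  interpret D1: prob_space "distr M N1 X" by (rule prob_space_distr) fact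
  interpret D2: prob_space "distr M N2 V" by (rule prob_space_distr) fact
  show ?thesis
  proof (rule pair_measure_eqI)
    show "sets (distr M N1 X \<Otimes>\<^sub>M distr M N2 V) = sets (distr M (N1 \<Otimes>\<^sub>M N2) (\<lambda>\<omega>. (X \<omega>, V \<omega>)))"
      by (simp cong: sets_pair_measure_cong)
    fix A B assume A: "A \<in> sets (distr M N1 X)" and B: "B \<in> sets (distr M N2 V)"
    have "(\<lambda>\<omega>. (X \<omega>, V \<omega>)) -` (A \<times> B) \<inter> space M = (X -` A \<inter> space M) \<inter> (V -` B \<inter> space M)"
      by auto
    then show "emeasure (distr M N1 X) A * emeasure (distr M N2 V) B =
        emeasure (distr M (N1 \<Otimes>\<^sub>M N2) (\<lambda>\<omega>. (X \<omega>, V \<omega>))) (A \<times> B)"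
      using A B indep
      by (simp add: emeasure_distr emeasure_eq_measure ennreal_mult'[symmetric] indep_pair_def)
  qed unfold_locales
qed

text \<open>Fubini for independent variables, in the role of conditional expectation: a fresh sample
  \<open>V\<close> is integrated out while \<open>X\<close> is frozen.\<close>

lemma (in prob_space) integral_indep_pair:
  fixes h :: "_ \<Rightarrow> real"
  assumes indep: "indep_pair N1 X N2 V"
    and h[measurable]: "h \<in> borel_measurable (N1 \<Otimes>\<^sub>M N2)"
    and int: "integrable M (\<lambda>\<omega>. h (X \<omega>, V \<omega>))"
  shows "integrable M (\<lambda>\<omega>. \<integral>y. h (X \<omega>, y) \<partial>distr M N2 V)"
    and "(\<integral>\<omega>. h (X \<omega>, V \<omega>) \<partial>M) = (\<integral>\<omega>. (\<integral>y. h (X \<omega>, y) \<partial>distr M N2 V) \<partial>M)"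
proof -
  have X[measurable]: "X \<in> measurable M N1" and V[measurable]: "V \<in> measurable M N2"
    and D: "distr M N1 X \<Otimes>\<^sub>M distr M N2 V = distr M (N1 \<Otimes>\<^sub>M N2) (\<lambda>\<omega>. (X \<omega>, V \<omega>))"
    using indep distr_indep_pair[OF indep] by (auto simp: indep_pair_def)
  interpret D1: prob_space "distr M N1 X" by (rule prob_space_distr) fact
  interpret D2: prob_space "distr M N2 V" by (rule prob_space_distr) fact
  interpret pair_sigma_finite "distr M N1 X" "distr M N2 V" ..
  have *: "integrable (distr M N1 X \<Otimes>\<^sub>M distr M N2 V) h"
    unfolding D using int by (subst integrable_distr_eq) simp_all
  have inner[measurable]: "(\<lambda>x. \<integral>y. h (x, y) \<partial>distr M N2 V) \<in> borel_measurable N1"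
    by (rule D2.borel_measurable_lebesgue_integral) simp
  show "integrable M (\<lambda>\<omega>. \<integral>y. h (X \<omega>, y) \<partial>distr M N2 V)"
    using integrable_fst'[OF *] by (subst (asm) integrable_distr_eq) simp_all
  have "(\<integral>\<omega>. h (X \<omega>, V \<omega>) \<partial>M) = integral\<^sup>L (distr M N1 X \<Otimes>\<^sub>M distr M N2 V) h"
    unfolding D by (subst integral_distr) simp_all
  also have "\<dots> = (\<integral>x. (\<integral>y. h (x, y) \<partial>distr M N2 V) \<partial>distr M N1 X)"
    by (rule integral_fst'[OF *, symmetric])
  also have "\<dots> = (\<integral>\<omega>. (\<integral>y. h (X \<omega>, y) \<partial>distr M N2 V) \<partial>M)"
    by (subst integral_distr) simp_all
  finally show "(\<integral>\<omega>. h (X \<omega>, V \<omega>) \<partial>M) = (\<integral>\<omega>. (\<integral>y. h (X \<omega>, y) \<partial>distr M N2 V) \<partial>M)" .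
qed

section \<open>Gradient noise of the stochastic objective\<close>

locale smooth_convex_objective = prob_space M
  for M :: "'x measure" +
  fixes f :: "'a::euclidean_space \<Rightarrow> 'x \<Rightarrow> real" and F :: "'a \<Rightarrow> real"
    and w_star :: 'a and L \<mu> \<sigma> :: real
  assumes f_diff: "\<And>x w. x \<in> space M \<Longrightarrow> (\<lambda>u. f u x) differentiable at w"
    and f_integrable: "\<And>w. integrable M (f w)"
    and F_def: "F = expected_loss M f"
    and F_diff: "\<And>w. F differentiable at w"
    and sgrad_integrable: "\<And>w. integrable M (sgrad f w)"
    and sgrad_unbiased: "\<And>w. (\<integral>x. sgrad f w x \<partial>M) = grad F w"
    and L_pos: "L > 0"
    and f_convex: "\<And>x. x \<in> space M \<Longrightarrow> convex_on UNIV (\<lambda>u. f u x)"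
    and f_smooth: "\<And>x. x \<in> space M \<Longrightarrow> L_smooth L (\<lambda>u. f u x)"
    and mu_pos: "\<mu> > 0"
    and F_strongly_convex: "strongly_convex \<mu> F"
    and w_star_min: "\<And>w. F w_star \<le> F w"
    and sigma_integrable: "integrable M (\<lambda>x. (norm (sgrad f w_star x))\<^sup>2)"
    and sigma_bound: "(\<integral>x. (norm (sgrad f w_star x))\<^sup>2 \<partial>M) \<le> \<sigma>\<^sup>2"
begin

lemma sgrad_Lipschitz:
  "x \<in> space M \<Longrightarrow> norm (sgrad f w x - sgrad f w' x) \<le> L * norm (w - w')"
  using f_smooth by (simp add: L_smooth_def sgrad_def)

lemma sgrad_cocoercive:
  "x \<in> space M \<Longrightarrow>
    (norm (sgrad f w x - sgrad f w' x))\<^sup>2 \<le> L * inner (sgrad f w x - sgrad f w' x) (w - w')"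
  unfolding sgrad_def by (rule grad_cocoercive) (auto intro: f_smooth f_diff f_convex L_pos)

text \<open>The gradient of \<open>F\<close> is the mean of the stochastic gradients, so averaging
  preserves the Lipschitz constant.\<close>

lemma F_smooth: "L_smooth L F"
  unfolding L_smooth_def
proof (intro allI)
  fix w w'
  have "norm (grad F w - grad F w') = norm (\<integral>x. sgrad f w x - sgrad f w' x \<partial>M)"
    by (simp add: sgrad_unbiased sgrad_integrable)
  also have "\<dots> \<le> (\<integral>x. norm (sgrad f w x - sgrad f w' x) \<partial>M)"
    by (rule integral_norm_bound)
  also have "\<dots> \<le> (\<integral>x. L * norm (w - w') \<partial>M)"
    by (intro integral_mono integrable_norm Bochner_Integration.integrable_diff)
      (auto intro: sgrad_Lipschitz sgrad_integrable)
  finally show "norm (grad F w - grad F w') \<le> L * norm (w - w')"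
    by (simp add: prob_space)
qed

lemma gradF_measurable[measurable]: "grad F \<in> borel_measurable borel"
  using L_smooth_imp_continuous_grad[OF F_smooth] L_pos
  by (intro borel_measurable_continuous_onI) simp

lemma F_measurable[measurable]: "F \<in> borel_measurable borel"
  using F_diff
  by (intro borel_measurable_continuous_onI)
    (simp add: continuous_on_eq_continuous_at differentiable_imp_continuous_within)

lemma sgrad_measurable: "(\<lambda>p. sgrad f (fst p) (snd p)) \<in> borel_measurable (borel \<Otimes>\<^sub>M M)"
proof (rule borel_measurable_Caratheodory)
  show "sgrad f w \<in> borel_measurable M" for w
    using sgrad_integrable by (rule borel_measurable_integrable)
  show "continuous_on UNIV (\<lambda>w. sgrad f w x)" if "x \<in> space M" for x
    using L_smooth_imp_continuous_grad[OF f_smooth[OF that]] L_pos by (simp add: sgrad_def)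
qed

lemma sgrad_measurable'[measurable (raw)]:
  assumes "W \<in> borel_measurable N" "V \<in> measurable N M"
  shows "(\<lambda>\<omega>. sgrad f (W \<omega>) (V \<omega>)) \<in> borel_measurable N"
  using measurable_compose[OF measurable_Pair[OF assms] sgrad_measurable] by simp

lemma gradF_w_star: "grad F w_star = 0"
  by (rule grad_at_minimum[OF F_diff w_star_min])

lemma norm_gradF_le: "norm (grad F w) \<le> L * norm (w - w_star)"
  using F_smooth[unfolded L_smooth_def, rule_format, of w w_star] by (simp add: gradF_w_star)

lemma F_gap_le: "F w - F w_star \<le> (norm (grad F w))\<^sup>2 / (2 * \<mu>)"
  by (rule strongly_convex_gap_le[OF F_strongly_convex mu_pos])

text \<open>At distance one from the minimizer, the strong convexity bound and the smoothness bound
  enclose the same gap of \<open>F\<close>.\<close>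

lemma mu_le_L: "\<mu> \<le> L"
proof -
  obtain e :: 'a where e: "norm e = 1"
    using vector_choose_size[of 1] by auto
  have "\<mu> / 2 \<le> F (w_star + e) - F w_star"
    using F_strongly_convex[unfolded strongly_convex_def, rule_format, of w_star "w_star + e"]
    by (simp add: gradF_w_star e)
  also have "\<dots> \<le> L / 2"
    using L_smooth_upper_bound[OF F_smooth F_diff, of "w_star + e" w_star]
    by (simp add: gradF_w_star e)
  finally show ?thesis by simp
qed

text \<open>A finite second moment is assumed only at \<open>w_star\<close>; the Lipschitz bound
  carries it to every point.\<close>

lemma sgrad_square_integrable: "square_integrable M (sgrad f w)"
proof (rule square_integrable_bound)
  show "square_integrable M (\<lambda>x. norm (sgrad f w_star x) + L * norm (w - w_star))"
    using sigma_integrable sgrad_integrable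
    by (intro square_integrable_add square_integrable_norm square_integrable_const)
      (simp add: square_integrable_def borel_measurable_integrable)
  show "norm (sgrad f w x) \<le> norm (norm (sgrad f w_star x) + L * norm (w - w_star))"
    if "x \<in> space M" for x
    using sgrad_Lipschitz[OF that, of w w_star] norm_triangle_sub[of "sgrad f w x" "sgrad f w_star x"]
      L_pos by (simp add: algebra_simps)
qed (use sgrad_integrable in \<open>rule borel_measurable_integrable\<close>)

text \<open>Split the gradient at \<open>w\<close> into its value at \<open>w_star\<close> and the
  difference. The squared difference is at most \<open>2 * L\<close> times the gap between
  \<open>f\<close> and its tangent at \<open>w_star\<close>. In the mean the tangent term vanishes,
  and \<open>F_gap_le\<close> bounds what remains, so that \<open>4 * L / (2 * \<mu>)\<close>
  becomes the factor of the squared gradient.\<close>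

lemma sgrad_second_moment:
  "(\<integral>x. (norm (sgrad f w x))\<^sup>2 \<partial>M) \<le> 2 * (L / \<mu>) * (norm (grad F w))\<^sup>2 + 2 * \<sigma>\<^sup>2"
proof -
  have "(\<integral>x. (norm (sgrad f w x))\<^sup>2 \<partial>M) \<le>
      (\<integral>x. 4 * L * (f w x - f w_star x - inner (sgrad f w_star x) (w - w_star))
        + 2 * (norm (sgrad f w_star x))\<^sup>2 \<partial>M)"
  proof (rule integral_mono)
    fix x assume x: "x \<in> space M"
    have "(norm (sgrad f w x - sgrad f w_star x))\<^sup>2 / (2 * L) \<le>
        f w x - f w_star x - inner (sgrad f w_star x) (w - w_star)"
      using smooth_convex_lower_bound[OF f_smooth[OF x] f_diff[OF x] f_convex[OF x] L_pos, of w_star w]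
      by (simp add: sgrad_def)
    then have "2 * (norm (sgrad f w x - sgrad f w_star x))\<^sup>2 \<le>
        4 * L * (f w x - f w_star x - inner (sgrad f w_star x) (w - w_star))"
      using L_pos by (simp add: field_simps)
    then show "(norm (sgrad f w x))\<^sup>2 \<le>
        4 * L * (f w x - f w_star x - inner (sgrad f w_star x) (w - w_star))
        + 2 * (norm (sgrad f w_star x))\<^sup>2"
      using norm_add_square_le[of "sgrad f w x - sgrad f w_star x" "sgrad f w_star x"] by simp
  next
    show "integrable M (\<lambda>x. (norm (sgrad f w x))\<^sup>2)"
      by (rule square_integrableD(2)[OF sgrad_square_integrable])
    show "integrable M (\<lambda>x. 4 * L * (f w x - f w_star x - inner (sgrad f w_star x) (w - w_star))
        + 2 * (norm (sgrad f w_star x))\<^sup>2)"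
      by (intro Bochner_Integration.integrable_add Bochner_Integration.integrable_diff
          integrable_mult_right integrable_inner_left f_integrable sgrad_integrable sigma_integrable)
  qed
  also have "\<dots> = 4 * L * (F w - F w_star - inner (grad F w_star) (w - w_star))
      + 2 * (\<integral>x. (norm (sgrad f w_star x))\<^sup>2 \<partial>M)"
    using sgrad_integrable f_integrable sigma_integrable
    by (simp add: F_def expected_loss_def sgrad_unbiased[unfolded F_def, symmetric])
  also have "\<dots> \<le> 4 * L * ((norm (grad F w))\<^sup>2 / (2 * \<mu>)) + 2 * \<sigma>\<^sup>2"
    using F_gap_le[of w] sigma_bound L_pos
    by (intro add_mono mult_left_mono) (simp_all add: gradF_w_star)
  finally show ?thesis by simp
qed

section \<open>Gradient noise at random points\<close>

definition noise :: "'a \<Rightarrow> 'x \<Rightarrow> 'a" where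
  "noise w x = sgrad f w x - grad F w"

lemma noise_measurable[measurable (raw)]:
  assumes [measurable]: "W \<in> borel_measurable N" "V \<in> measurable N M"
  shows "(\<lambda>\<omega>. noise (W \<omega>) (V \<omega>)) \<in> borel_measurable N"
  unfolding noise_def by measurable

lemma noise_mean_zero: "integrable M (noise w)" "(\<integral>x. noise w x \<partial>M) = 0"
proof -
  have "noise w = (\<lambda>x. sgrad f w x - grad F w)" by (simp add: noise_def fun_eq_iff)
  then show "integrable M (noise w)" "(\<integral>x. noise w x \<partial>M) = 0"
    using sgrad_integrable sgrad_unbiased by (simp_all add: prob_space)
qed

lemma gradF_square_integrable:
  assumes "square_integrable P (\<lambda>\<omega>. W \<omega> - w_star)" "W \<in> borel_measurable P"
  shows "square_integrable P (\<lambda>\<omega>. grad F (W \<omega>))"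
proof (rule square_integrable_bound)
  show "square_integrable P (\<lambda>\<omega>. L *\<^sub>R (W \<omega> - w_star))"
    by (rule square_integrable_scaleR) fact
qed (use assms L_pos norm_gradF_le in auto)

text \<open>The gap to the minimum lies between zero and a multiple of the squared gradient norm,
  which is integrable.\<close>

lemma F_integrable:
  assumes "prob_space P" "square_integrable P (\<lambda>\<omega>. W \<omega> - w_star)" "W \<in> borel_measurable P"
  shows "integrable P (\<lambda>\<omega>. F (W \<omega>))"
proof -
  interpret P: prob_space P by fact
  note [measurable] = assms(3)
  have "integrable P (\<lambda>\<omega>. F (W \<omega>) - F w_star)"
  proof (rule Bochner_Integration.integrable_bound)
    show "integrable P (\<lambda>\<omega>. (norm (grad F (W \<omega>)))\<^sup>2 / (2 * \<mu>))"
      using square_integrableD[OF gradF_square_integrable[OF assms(2,3)]] by simp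
    show "AE \<omega> in P. norm (F (W \<omega>) - F w_star) \<le> norm ((norm (grad F (W \<omega>)))\<^sup>2 / (2 * \<mu>))"
      using F_gap_le w_star_min mu_pos by simp
  qed measurable
  from Bochner_Integration.integrable_add[OF this P.integrable_const[of "F w_star"]]
  show ?thesis by simp
qed

text \<open>The Lipschitz bound holds along each realization, so this is valid for any dependence
  between \<open>W\<close> and \<open>V\<close>.\<close>

lemma sgrad_compose_square_integrable:
  assumes P: "prob_space P" and W: "square_integrable P (\<lambda>\<omega>. W \<omega> - w_star)"
    and W'[measurable]: "W \<in> borel_measurable P"
    and V[measurable]: "V \<in> measurable P M" and distr: "distr P M V = M"
  shows "square_integrable P (\<lambda>\<omega>. sgrad f (W \<omega>) (V \<omega>))"
proof (rule square_integrable_bound)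
  have "sgrad f w_star \<in> borel_measurable M"
    using sgrad_integrable by (rule borel_measurable_integrable)
  moreover have "integrable P (\<lambda>\<omega>. (norm (sgrad f w_star (V \<omega>)))\<^sup>2)"
    using sigma_integrable by (subst (asm) distr[symmetric], subst (asm) integrable_distr_eq)
      (simp_all add: calculation)
  ultimately have "square_integrable P (\<lambda>\<omega>. sgrad f w_star (V \<omega>))"
    by (simp add: square_integrable_def)
  then show "square_integrable P (\<lambda>\<omega>. norm (sgrad f w_star (V \<omega>)) + norm (L *\<^sub>R (W \<omega> - w_star)))"
    by (intro square_integrable_add square_integrable_norm square_integrable_scaleR W)
  show "norm (sgrad f (W \<omega>) (V \<omega>)) \<le>
      norm (norm (sgrad f w_star (V \<omega>)) + norm (L *\<^sub>R (W \<omega> - w_star)))" if "\<omega> \<in> space P" for \<omega>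
    using sgrad_Lipschitz[of "V \<omega>" "W \<omega>" w_star] measurable_space[OF V that] L_pos
      norm_triangle_sub[of "sgrad f (W \<omega>) (V \<omega>)" "sgrad f w_star (V \<omega>)"] by simp
qed measurable

lemma noise_compose_square_integrable:
  assumes "prob_space P" "square_integrable P (\<lambda>\<omega>. W \<omega> - w_star)"
    "W \<in> borel_measurable P" "V \<in> measurable P M" "distr P M V = M"
  shows "square_integrable P (\<lambda>\<omega>. noise (W \<omega>) (V \<omega>))"
  unfolding noise_def
  by (intro square_integrable_diff sgrad_compose_square_integrable gradF_square_integrable assms)

text \<open>The martingale difference property: integrating out \<open>V\<close> with
  \<open>U\<close> and \<open>W\<close> frozen leaves the mean of the noise, which is zero.
  Independence is required of the pair because \<open>U\<close> and \<open>W\<close> may depend on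
  each other.\<close>

lemma noise_orthogonal:
  assumes P: "prob_space P" and W: "square_integrable P (\<lambda>\<omega>. W \<omega> - w_star)"
    and U: "square_integrable P U"
    and indep: "prob_space.indep_pair P (borel \<Otimes>\<^sub>M borel) (\<lambda>\<omega>. (U \<omega>, W \<omega>)) M V"
    and W'[measurable]: "W \<in> borel_measurable P"
    and V[measurable]: "V \<in> measurable P M" and distr: "distr P M V = M"
  shows "(\<integral>\<omega>. inner (U \<omega>) (noise (W \<omega>) (V \<omega>)) \<partial>P) = 0"
proof -
  interpret P: prob_space P by fact
  let ?h = "\<lambda>p. inner (fst (fst p)) (noise (snd (fst p)) (snd p))"
  have "(\<integral>\<omega>. ?h ((U \<omega>, W \<omega>), V \<omega>) \<partial>P) = (\<integral>\<omega>. (\<integral>y. ?h ((U \<omega>, W \<omega>), y) \<partial>distr P M V) \<partial>P)"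
    using square_integrable_inner[OF U noise_compose_square_integrable[OF P W W' V distr]]
    by (intro P.integral_indep_pair[OF indep]) simp_all
  also have "\<dots> = 0"
    by (simp add: distr noise_mean_zero)
  finally show ?thesis by simp
qed

lemma sgrad_compose_second_moment:
  assumes P: "prob_space P" and W: "square_integrable P (\<lambda>\<omega>. W \<omega> - w_star)"
    and indep: "prob_space.indep_pair P borel W M V"
    and W'[measurable]: "W \<in> borel_measurable P"
    and V[measurable]: "V \<in> measurable P M" and distr: "distr P M V = M"
  shows "(\<integral>\<omega>. (norm (sgrad f (W \<omega>) (V \<omega>)))\<^sup>2 \<partial>P)
    \<le> 2 * (L / \<mu>) * (\<integral>\<omega>. (norm (grad F (W \<omega>)))\<^sup>2 \<partial>P) + 2 * \<sigma>\<^sup>2"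
proof -
  interpret P: prob_space P by fact
  let ?h = "\<lambda>p. (norm (sgrad f (fst p) (snd p)))\<^sup>2"
  have h: "?h \<in> borel_measurable (borel \<Otimes>\<^sub>M M)" by measurable
  have int: "integrable P (\<lambda>\<omega>. ?h (W \<omega>, V \<omega>))"
    using square_integrableD[OF sgrad_compose_square_integrable[OF P W W' V distr]] by simp
  note fubini = P.integral_indep_pair[OF indep h int, unfolded distr, simplified]
  have gint: "integrable P (\<lambda>\<omega>. (norm (grad F (W \<omega>)))\<^sup>2)"
    by (rule square_integrableD(2)[OF gradF_square_integrable[OF W W']])
  have "(\<integral>\<omega>. (norm (sgrad f (W \<omega>) (V \<omega>)))\<^sup>2 \<partial>P) \<le>
      (\<integral>\<omega>. 2 * (L / \<mu>) * (norm (grad F (W \<omega>)))\<^sup>2 + 2 * \<sigma>\<^sup>2 \<partial>P)"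
    unfolding fubini(2)
    by (intro integral_mono fubini(1) sgrad_second_moment) (simp add: gint)
  also have "\<dots> = 2 * (L / \<mu>) * (\<integral>\<omega>. (norm (grad F (W \<omega>)))\<^sup>2 \<partial>P) + 2 * \<sigma>\<^sup>2"
    using gint by (simp add: P.prob_space)
  finally show ?thesis .
qed

text \<open>The stochastic gradient is the orthogonal sum of \<open>grad F\<close> and the noise.
  Subtracting the squared gradient from the second moment produces the \<open>- 1\<close> in the
  factor.\<close>

lemma noise_compose_second_moment:
  assumes P: "prob_space P" and W: "square_integrable P (\<lambda>\<omega>. W \<omega> - w_star)"
    and indep: "prob_space.indep_pair P borel W M V"
    and W'[measurable]: "W \<in> borel_measurable P"
    and V[measurable]: "V \<in> measurable P M" and distr: "distr P M V = M"
  shows "(\<integral>\<omega>. (norm (noise (W \<omega>) (V \<omega>)))\<^sup>2 \<partial>P)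
    \<le> (2 * (L / \<mu>) - 1) * (\<integral>\<omega>. (norm (grad F (W \<omega>)))\<^sup>2 \<partial>P) + 2 * \<sigma>\<^sup>2"
proof -
  interpret P: prob_space P by fact
  have "P.indep_pair (borel \<Otimes>\<^sub>M borel) (\<lambda>\<omega>. (grad F (W \<omega>), W \<omega>)) M V"
    by (rule P.indep_pair_compose[OF indep]) simp
  from noise_orthogonal[OF P W gradF_square_integrable[OF W W'] this W' V distr]
  have "(\<integral>\<omega>. (norm (grad F (W \<omega>) + noise (W \<omega>) (V \<omega>)))\<^sup>2 \<partial>P) =
      (\<integral>\<omega>. (norm (grad F (W \<omega>)))\<^sup>2 \<partial>P) + (\<integral>\<omega>. (norm (noise (W \<omega>) (V \<omega>)))\<^sup>2 \<partial>P)"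
    by (intro integral_norm_add_orthogonal gradF_square_integrable
        noise_compose_square_integrable assms)
  then show ?thesis
    using sgrad_compose_second_moment[OF assms] by (simp add: noise_def algebra_simps)
qed

end

section \<open>Convergence of the iterates\<close>

primrec stage :: "source \<Rightarrow> nat" where
  "stage (Initial s i) = s"
| "stage (Step s t) = s"
| "stage (Index s) = s"

lemma Int_stable_vimage: "Int_stable {V -` A \<inter> S | A. A \<in> sets N}"
proof (rule Int_stableI)
  fix a b assume "a \<in> {V -` A \<inter> S | A. A \<in> sets N}" "b \<in> {V -` A \<inter> S | A. A \<in> sets N}"
  then obtain A B where "a = V -` A \<inter> S" "b = V -` B \<inter> S" "A \<in> sets N" "B \<in> sets N"
    by auto
  then show "a \<inter> b \<in> {V -` A \<inter> S | A. A \<in> sets N}"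
    by (intro CollectI exI[of _ "A \<inter> B"]) auto
qed

text \<open>Intersection stability lets independence of the generating events be lifted to the
  sigma-algebras they generate.\<close>

lemma Int_stable_source_events: "Int_stable (source_events P M \<zeta> \<xi> T c)"
  using Int_stable_vimage[of "T s" "space P" "count_space UNIV" for s]
  by (cases c) (simp_all add: Int_stable_vimage)

locale isarah_run = smooth_convex_objective M f F w_star L \<mu> \<sigma> + P: prob_space P
  for M :: "'x measure" and f :: "'a::euclidean_space \<Rightarrow> 'x \<Rightarrow> real" and F :: "'a \<Rightarrow> real"
    and w_star :: 'a and L \<mu> \<sigma> :: real and P :: "'o measure" +
  fixes w0 :: 'a and \<eta> :: real and m b :: nat
    and \<zeta> \<xi> :: "nat \<Rightarrow> nat \<Rightarrow> 'o \<Rightarrow> 'x" and T :: "nat \<Rightarrow> 'o \<Rightarrow> nat"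
  assumes b_pos: "b > 0" and eta_pos: "0 < \<eta>" and eta_le: "\<eta> \<le> 1 / L"
    and sampling: "isarah_sampling P M m b \<zeta> \<xi> T"
begin

section \<open>Sigma-algebras generated by sets of random sources, and their independence\<close>

definition sources :: "source set" where
  "sources = {Initial s i | s i. s \<ge> 1 \<and> i \<in> {1..b}} \<union> {Step s t | s t. s \<ge> 1 \<and> t \<ge> 1} \<union>
    {Index s | s. s \<ge> 1}"

text \<open>Only the sets of this measure space matter: measurability with respect to it expresses
  being determined by the sources in \<open>A\<close>.\<close>

definition generated :: "source set \<Rightarrow> 'o measure" where
  "generated A = sigma (space P) (\<Union>c\<in>A. source_events P M \<zeta> \<xi> T c)"

lemma zeta_sample: "s \<ge> 1 \<Longrightarrow> i \<in> {1..b} \<Longrightarrow> \<zeta> s i \<in> measurable P M"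
    "s \<ge> 1 \<Longrightarrow> i \<in> {1..b} \<Longrightarrow> distr P M (\<zeta> s i) = M"
  and xi_sample: "s \<ge> 1 \<Longrightarrow> t \<ge> 1 \<Longrightarrow> \<xi> s t \<in> measurable P M"
    "s \<ge> 1 \<Longrightarrow> t \<ge> 1 \<Longrightarrow> distr P M (\<xi> s t) = M"
  and T_sample: "s \<ge> 1 \<Longrightarrow> T s \<in> measurable P (count_space UNIV)"
    "s \<ge> 1 \<Longrightarrow> distr P (count_space UNIV) (T s) = measure_pmf (pmf_of_set {0..m})"
  and indep_sources: "P.indep_sets (source_events P M \<zeta> \<xi> T) sources"
  using sampling unfolding isarah_sampling_def sources_def by blast+

lemma source_events_Pow: "source_events P M \<zeta> \<xi> T c \<subseteq> Pow (space P)"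
  by (cases c) auto

lemma space_generated[simp]: "space (generated A) = space P"
  by (simp add: generated_def space_measure_of_conv)

lemma sets_generated: "sets (generated A) = sigma_sets (space P) (\<Union>c\<in>A. source_events P M \<zeta> \<xi> T c)"
  unfolding generated_def using source_events_Pow by (intro sets_measure_of) blast

lemma sets_generated_mono: "A \<subseteq> B \<Longrightarrow> sets (generated A) \<subseteq> sets (generated B)"
  unfolding sets_generated by (rule sigma_sets_mono') blast

lemma sets_generated_subset: "A \<subseteq> sources \<Longrightarrow> sets (generated A) \<subseteq> sets P"
  using indep_sources unfolding sets_generated P.indep_sets_def
  by (intro sets.sigma_sets_subset) blast

lemma measurable_generated_mono:
  "X \<in> measurable (generated A) N \<Longrightarrow> A \<subseteq> B \<Longrightarrow> X \<in> measurable (generated B) N"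
  using sets_generated_mono[of A B] by (auto simp: measurable_def)

lemma measurable_generated_imp_measurable:
  "X \<in> measurable (generated A) N \<Longrightarrow> A \<subseteq> sources \<Longrightarrow> X \<in> measurable P N"
  using sets_generated_subset[of A] by (auto simp: measurable_def)

lemma source_measurable_generated:
  assumes "c \<in> A" "V \<in> measurable P N"
    and "source_events P M \<zeta> \<xi> T c = {V -` B \<inter> space P | B. B \<in> sets N}"
  shows "V \<in> measurable (generated A) N"
proof (rule measurableI)
  show "V \<omega> \<in> space N" if "\<omega> \<in> space (generated A)" for \<omega>
    using that measurable_space[OF assms(2)] by simp
  show "V -` B \<inter> space (generated A) \<in> sets (generated A)" if "B \<in> sets N" for B
    unfolding sets_generated using that assms(1,3) by (intro sigma_sets.Basic) auto
qed

lemma zeta_measurable_generated: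
  "Initial s i \<in> A \<Longrightarrow> s \<ge> 1 \<Longrightarrow> i \<in> {1..b} \<Longrightarrow> \<zeta> s i \<in> measurable (generated A) M"
  by (rule source_measurable_generated[of "Initial s i"]) (simp_all add: zeta_sample)

lemma xi_measurable_generated:
  "Step s t \<in> A \<Longrightarrow> s \<ge> 1 \<Longrightarrow> t \<ge> 1 \<Longrightarrow> \<xi> s t \<in> measurable (generated A) M"
  by (rule source_measurable_generated[of "Step s t"]) (simp_all add: xi_sample)

lemma T_measurable_generated:
  "Index s \<in> A \<Longrightarrow> s \<ge> 1 \<Longrightarrow> T s \<in> measurable (generated A) (count_space UNIV)"
  by (rule source_measurable_generated[of "Index s"]) (simp_all add: T_sample)

text \<open>Grouping an independent family into disjoint blocks preserves independence. Here the
  blocks are \<open>A\<close> and the single source \<open>c\<close>, so anything determined by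
  \<open>A\<close> is independent of a variable generated by \<open>c\<close>.\<close>

lemma indep_pair_source:
  assumes A: "A \<subseteq> sources" and c: "c \<in> sources" "c \<notin> A"
    and X: "X \<in> measurable (generated A) N1" and V: "V \<in> measurable P N2"
    and events: "source_events P M \<zeta> \<xi> T c = {V -` B \<inter> space P | B. B \<in> sets N2}"
  shows "P.indep_pair N1 X N2 V"
  unfolding P.indep_pair_def
proof (intro conjI ballI)
  show "X \<in> measurable P N1" by (rule measurable_generated_imp_measurable[OF X A])
  show "V \<in> measurable P N2" by fact
  fix C D assume C: "C \<in> sets N1" and D: "D \<in> sets N2"
  \<comment> \<open>The blocks are indexed by booleans: \<open>True\<close> for \<open>A\<close> and
    \<open>False\<close> for \<open>c\<close>.\<close>
  let ?I = "case_bool A {c}"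
  have "P.indep_sets (\<lambda>j. sigma_sets (space P) (\<Union>i\<in>?I j. source_events P M \<zeta> \<xi> T i)) UNIV"
  proof (rule P.indep_sets_collect_sigma)
    show "P.indep_sets (source_events P M \<zeta> \<xi> T) (\<Union>j\<in>UNIV. ?I j)"
      by (rule P.indep_sets_mono_index[OF _ indep_sources]) (use A c in \<open>simp add: UNIV_bool\<close>)
    show "disjoint_family_on ?I UNIV"
      using c by (simp add: disjoint_family_on_def UNIV_bool)
  qed (rule Int_stable_source_events)
  moreover have "X -` C \<inter> space P \<in> sigma_sets (space P) (\<Union>i\<in>A. source_events P M \<zeta> \<xi> T i)"
    using measurable_sets[OF X C] by (simp add: sets_generated)
  moreover have "V -` D \<inter> space P \<in> sigma_sets (space P) (source_events P M \<zeta> \<xi> T c)"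
    using D by (intro sigma_sets.Basic) (auto simp: events)
  ultimately have "P.prob (\<Inter>j\<in>UNIV. case_bool (X -` C \<inter> space P) (V -` D \<inter> space P) j) =
      (\<Prod>j\<in>UNIV. P.prob (case_bool (X -` C \<inter> space P) (V -` D \<inter> space P) j))"
    by (intro P.indep_setsD) (auto simp: UNIV_bool)
  then show "P.prob ((X -` C \<inter> space P) \<inter> (V -` D \<inter> space P)) =
      P.prob (X -` C \<inter> space P) * P.prob (V -` D \<inter> space P)"
    by (simp add: UNIV_bool ac_simps)
qed

section \<open>The iterates and the information that determines them\<close>

abbreviation outer :: "nat \<Rightarrow> 'o \<Rightarrow> 'a" where
  "outer \<equiv> isarah f \<eta> b w0 \<zeta> \<xi> T"

text \<open>Index shift: \<open>inner_iter s\<close> is the call numbered \<open>Suc s\<close>,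
  which starts at \<open>outer s\<close> and uses the samples with first index
  \<open>Suc s\<close>.\<close>

definition inner_iter :: "nat \<Rightarrow> nat \<Rightarrow> 'o \<Rightarrow> 'a \<times> 'a" where
  "inner_iter s t \<omega> = isarah_in_iter f \<eta> b (outer s \<omega>)
    (\<lambda>i. \<zeta> (Suc s) i \<omega>) (\<lambda>t. \<xi> (Suc s) t \<omega>) t"

definition w :: "nat \<Rightarrow> nat \<Rightarrow> 'o \<Rightarrow> 'a" where "w s t \<omega> = fst (inner_iter s t \<omega>)"

definition v :: "nat \<Rightarrow> nat \<Rightarrow> 'o \<Rightarrow> 'a" where "v s t \<omega> = snd (inner_iter s t \<omega>)"

lemma w_0: "w s 0 = outer s"
  and v_0: "v s 0 = (\<lambda>\<omega>. (1 / real b) *\<^sub>R (\<Sum>i=1..b. sgrad f (outer s \<omega>) (\<zeta> (Suc s) i \<omega>)))"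
  and w_Suc: "w s (Suc t) = (\<lambda>\<omega>. w s t \<omega> - \<eta> *\<^sub>R v s t \<omega>)"
  and v_Suc: "v s (Suc t) = (\<lambda>\<omega>. sgrad f (w s (Suc t) \<omega>) (\<xi> (Suc s) (Suc t) \<omega>)
    - sgrad f (w s t \<omega>) (\<xi> (Suc s) (Suc t) \<omega>) + v s t \<omega>)"
  by (simp_all add: w_def v_def inner_iter_def fun_eq_iff Let_def split_beta)

lemma outer_Suc: "outer (Suc s) = (\<lambda>\<omega>. w s (T (Suc s) \<omega>) \<omega>)"
  by (simp add: w_def inner_iter_def fun_eq_iff)

declare isarah.simps(2) [simp del]

text \<open>What is known before call \<open>Suc s\<close>; the output index of call
  \<open>s\<close> is included, so that \<open>outer s\<close> is determined.\<close>

definition past :: "nat \<Rightarrow> source set" where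
  "past s = {c \<in> sources. stage c \<le> s}"

definition initial_past :: "nat \<Rightarrow> nat \<Rightarrow> source set" where
  "initial_past s n = past s \<union> {Initial (Suc s) i | i. i \<in> {1..b} \<and> i \<le> n}"

text \<open>The full mini-batch and the first \<open>t\<close> step samples of call
  \<open>Suc s\<close>. The output index of this call is left out, so it is independent of each
  inner iterate.\<close>

definition inner_past :: "nat \<Rightarrow> nat \<Rightarrow> source set" where
  "inner_past s t = initial_past s b \<union> {Step (Suc s) j | j. 1 \<le> j \<and> j \<le> t}"

lemma past_sources: "past s \<subseteq> sources" "initial_past s n \<subseteq> sources" "inner_past s t \<subseteq> sources"
  by (auto simp: past_def initial_past_def inner_past_def sources_def)

lemma past_subset: "past s \<subseteq> initial_past s n" "past s \<subseteq> inner_past s t"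
  "inner_past s t \<subseteq> inner_past s (Suc t)" "inner_past s t \<subseteq> past (Suc s)"
  by (auto simp: past_def initial_past_def inner_past_def sources_def)

text \<open>The assumption on \<open>outer s\<close> is discharged by a later induction on
  \<open>s\<close>, whose successor case relies on this lemma.\<close>

lemma inner_measurable_generated:
  assumes "outer s \<in> borel_measurable (generated (past s))"
  shows "w s t \<in> borel_measurable (generated (inner_past s t)) \<and> v s t \<in> borel_measurable (generated (inner_past s t))"
proof (induction t)
  case 0
  have [measurable]: "outer s \<in> borel_measurable (generated (inner_past s 0))"
    by (rule measurable_generated_mono[OF assms past_subset(2)])
  have [measurable]: "\<zeta> (Suc s) i \<in> measurable (generated (inner_past s 0)) M" if "i \<in> {1..b}" for i
    using that by (intro zeta_measurable_generated) (auto simp: inner_past_def initial_past_def)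
  show ?case
    unfolding w_0 v_0 by measurable
next
  case (Suc t)
  then have [measurable]: "w s t \<in> borel_measurable (generated (inner_past s (Suc t)))"
      "v s t \<in> borel_measurable (generated (inner_past s (Suc t)))"
    using measurable_generated_mono[OF _ past_subset(3)] by blast+
  have [measurable]: "\<xi> (Suc s) (Suc t) \<in> measurable (generated (inner_past s (Suc t))) M"
    by (intro xi_measurable_generated) (auto simp: inner_past_def)
  have [measurable]: "w s (Suc t) \<in> borel_measurable (generated (inner_past s (Suc t)))"
    unfolding w_Suc by measurable
  show ?case
    unfolding v_Suc by measurable
qed

lemma outer_measurable_generated: "outer s \<in> borel_measurable (generated (past s))"
proof (induction s)
  case 0
  show ?case by simp
next
  case (Suc s)
  have "w s t \<in> borel_measurable (generated (past (Suc s)))" for t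
    using inner_measurable_generated[OF Suc] measurable_generated_mono[OF _ past_subset(4)] by blast
  moreover have "T (Suc s) \<in> measurable (generated (past (Suc s))) (count_space UNIV)"
    by (rule T_measurable_generated) (auto simp: past_def sources_def)
  \<comment> \<open>The output is an iterate at a random index; measurability survives because the
    index has countably many values.\<close>
  ultimately show ?case
    unfolding outer_Suc by (rule measurable_compose_countable)
qed

lemma w_measurable_generated: "w s t \<in> borel_measurable (generated (inner_past s t))"
  and v_measurable_generated: "v s t \<in> borel_measurable (generated (inner_past s t))"
  using inner_measurable_generated[OF outer_measurable_generated] by blast+

lemma outer_measurable[measurable]: "outer s \<in> borel_measurable P"
  by (rule measurable_generated_imp_measurable[OF outer_measurable_generated past_sources(1)])

lemma w_measurable[measurable]: "w s t \<in> borel_measurable P"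
  by (rule measurable_generated_imp_measurable[OF w_measurable_generated past_sources(3)])

lemma v_measurable[measurable]: "v s t \<in> borel_measurable P"
  by (rule measurable_generated_imp_measurable[OF v_measurable_generated past_sources(3)])

lemma indep_zeta:
  assumes "X \<in> measurable (generated (initial_past s n)) N" "n < b"
  shows "P.indep_pair N X M (\<zeta> (Suc s) (Suc n))"
  using assms
  by (intro indep_pair_source[OF past_sources(2), of "Initial (Suc s) (Suc n)"])
    (auto simp: sources_def initial_past_def past_def zeta_sample)

lemma indep_xi:
  assumes "X \<in> measurable (generated (inner_past s t)) N"
  shows "P.indep_pair N X M (\<xi> (Suc s) (Suc t))"
  using assms
  by (intro indep_pair_source[OF past_sources(3), of "Step (Suc s) (Suc t)"])
    (auto simp: sources_def inner_past_def initial_past_def past_def xi_sample)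

lemma indep_T:
  assumes "X \<in> measurable (generated (inner_past s t)) N"
  shows "P.indep_pair N X (count_space UNIV) (T (Suc s))"
  using assms
  by (intro indep_pair_source[OF past_sources(3), of "Index (Suc s)"])
    (auto simp: sources_def inner_past_def initial_past_def past_def T_sample)

section \<open>Estimates along a single realization\<close>

lemma eta_L: "0 < \<eta> * L" "\<eta> * L \<le> 1"
  using eta_pos eta_le L_pos by (simp_all add: field_simps)

text \<open>Consecutive points differ by \<open>- \<eta> *\<^sub>R v s t \<omega>\<close>, so
  cocoercivity bounds the squared increment \<open>g\<close> of \<open>v\<close> by
  \<open>- \<eta> * L\<close> times the inner product of \<open>v s t \<omega>\<close> and
  \<open>g\<close>. Expanding the squared norm of \<open>v s t \<omega> + g\<close> turns that
  product into a difference of squared norms.\<close>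

lemma v_step_bound:
  assumes "\<omega> \<in> space P"
  shows "(2 - \<eta> * L) * (norm (v s (Suc t) \<omega> - v s t \<omega>))\<^sup>2
    \<le> \<eta> * L * ((norm (v s t \<omega>))\<^sup>2 - (norm (v s (Suc t) \<omega>))\<^sup>2)"
proof -
  define g where "g = v s (Suc t) \<omega> - v s t \<omega>"
  have v': "v s (Suc t) \<omega> = v s t \<omega> + g" by (simp add: g_def)
  have "\<xi> (Suc s) (Suc t) \<omega> \<in> space M"
    by (rule measurable_space[OF xi_sample(1) assms]) auto
  from sgrad_cocoercive[OF this, of "w s (Suc t) \<omega>" "w s t \<omega>"]
  have "(norm g)\<^sup>2 \<le> L * inner g (- (\<eta> *\<^sub>R v s t \<omega>))"
    unfolding g_def v_Suc by (simp add: w_Suc)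
  moreover have "L * inner g (- (\<eta> *\<^sub>R v s t \<omega>)) = - (\<eta> * L * inner (v s t \<omega>) g)"
    by (simp add: inner_commute)
  moreover have "(norm (v s (Suc t) \<omega>))\<^sup>2 = (norm (v s t \<omega>))\<^sup>2 + 2 * inner (v s t \<omega>) g + (norm g)\<^sup>2"
    unfolding v' by (simp add: power2_norm_eq_inner inner_add_left inner_add_right inner_commute)
  ultimately show ?thesis
    unfolding g_def[symmetric] by (simp only: left_diff_distrib right_diff_distrib distrib_left)
qed

text \<open>Serves to dominate all \<open>v s t\<close> by \<open>v s 0\<close>, which gives their
  square integrability.\<close>

lemma norm_v_le:
  assumes "\<omega> \<in> space P"
  shows "norm (v s t \<omega>) \<le> norm (v s 0 \<omega>)"
proof (induction t)
  case (Suc t)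
  have "0 \<le> (2 - \<eta> * L) * (norm (v s (Suc t) \<omega> - v s t \<omega>))\<^sup>2"
    using eta_L by simp
  also note v_step_bound[OF assms]
  finally have "(norm (v s (Suc t) \<omega>))\<^sup>2 \<le> (norm (v s t \<omega>))\<^sup>2"
    using eta_L(1) by (simp add: zero_le_mult_iff)
  then have "norm (v s (Suc t) \<omega>) \<le> norm (v s t \<omega>)"
    by (rule power2_le_imp_le) simp
  with Suc show ?case by simp
qed simp

lemma zeta_sample_Suc: "n < b \<Longrightarrow> \<zeta> (Suc s) (Suc n) \<in> measurable P M"
    "n < b \<Longrightarrow> distr P M (\<zeta> (Suc s) (Suc n)) = M"
  and xi_sample_Suc: "\<xi> (Suc s) (Suc t) \<in> measurable P M" "distr P M (\<xi> (Suc s) (Suc t)) = M"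
  by (auto intro: zeta_sample xi_sample)

definition err :: "nat \<Rightarrow> nat \<Rightarrow> 'o \<Rightarrow> 'a" where
  "err s t \<omega> = v s t \<omega> - grad F (w s t \<omega>)"

lemma err_measurable_generated: "err s t \<in> borel_measurable (generated (inner_past s t))"
proof -
  note [measurable] = v_measurable_generated[of s t] w_measurable_generated[of s t]
  show ?thesis unfolding err_def by measurable
qed

lemma err_0: "err s 0 \<omega> = (1 / real b) *\<^sub>R (\<Sum>i<b. noise (outer s \<omega>) (\<zeta> (Suc s) (Suc i) \<omega>))"
proof -
  have "(\<Sum>i=1..b. sgrad f (outer s \<omega>) (\<zeta> (Suc s) i \<omega>)) =
      (\<Sum>i<b. sgrad f (outer s \<omega>) (\<zeta> (Suc s) (Suc i) \<omega>))"
    by (rule sum.reindex_bij_witness[of _ Suc "\<lambda>i. i - 1"]) auto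
  then show ?thesis
    using b_pos by (simp add: err_def v_0 w_0 noise_def sum_subtractf scaleR_diff_right
        sum_constant_scaleR)
qed

text \<open>The martingale increment: both noise terms use the same fresh sample, at two points
  fixed before it is drawn.\<close>

lemma err_Suc: "err s (Suc t) \<omega> = err s t \<omega> +
    (noise (w s (Suc t) \<omega>) (\<xi> (Suc s) (Suc t) \<omega>) - noise (w s t \<omega>) (\<xi> (Suc s) (Suc t) \<omega>))"
  by (simp add: err_def v_Suc noise_def)

section \<open>Second moments within one inner call\<close>

context
  fixes s
  assumes outer_square_integrable: "square_integrable P (\<lambda>\<omega>. outer s \<omega> - w_star)"
begin

lemma zeta_noise_square_integrable:
  "n < b \<Longrightarrow> square_integrable P (\<lambda>\<omega>. noise (outer s \<omega>) (\<zeta> (Suc s) (Suc n) \<omega>))"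
  using zeta_sample_Suc outer_square_integrable
  by (intro noise_compose_square_integrable P.prob_space_axioms outer_measurable) auto

lemma err_0_square_integrable: "square_integrable P (err s 0)"
proof -
  have "err s 0 = (\<lambda>\<omega>. (1 / real b) *\<^sub>R (\<Sum>i<b. noise (outer s \<omega>) (\<zeta> (Suc s) (Suc i) \<omega>)))"
    by (simp add: err_0 fun_eq_iff)
  then show ?thesis
    by (auto intro!: square_integrable_scaleR P.square_integrable_sum zeta_noise_square_integrable)
qed

lemma gradF_outer_square_integrable: "square_integrable P (\<lambda>\<omega>. grad F (outer s \<omega>))"
  by (rule gradF_square_integrable[OF outer_square_integrable outer_measurable])

lemma v_square_integrable: "square_integrable P (v s t)"
proof (rule square_integrable_bound[of _ "v s 0"])
  have "v s 0 = (\<lambda>\<omega>. grad F (outer s \<omega>) + err s 0 \<omega>)"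
    by (simp add: err_def w_0 fun_eq_iff)
  then show "square_integrable P (v s 0)"
    using square_integrable_add[OF gradF_outer_square_integrable err_0_square_integrable] by simp
qed (use norm_v_le in auto)

lemma w_square_integrable: "square_integrable P (\<lambda>\<omega>. w s t \<omega> - w_star)"
proof (induction t)
  case 0
  show ?case using outer_square_integrable by (simp add: w_0)
next
  case (Suc t)
  from square_integrable_diff[OF this square_integrable_scaleR[OF v_square_integrable[of t], of \<eta>]]
  show ?case by (simp add: w_Suc algebra_simps)
qed

lemma gradF_w_square_integrable: "square_integrable P (\<lambda>\<omega>. grad F (w s t \<omega>))"
  by (rule gradF_square_integrable[OF w_square_integrable w_measurable])

lemma err_square_integrable: "square_integrable P (err s t)"
proof -
  have "err s t = (\<lambda>\<omega>. v s t \<omega> - grad F (w s t \<omega>))"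
    by (simp add: err_def fun_eq_iff)
  then show ?thesis using square_integrable_diff[OF v_square_integrable gradF_w_square_integrable] by simp
qed

lemma zeta_noise_orthogonal:
  assumes U: "U \<in> borel_measurable (generated (initial_past s n))" "square_integrable P U" and "n < b"
  shows "(\<integral>\<omega>. inner (U \<omega>) (noise (outer s \<omega>) (\<zeta> (Suc s) (Suc n) \<omega>)) \<partial>P) = 0"
proof (rule noise_orthogonal[OF P.prob_space_axioms outer_square_integrable U(2)])
  have "outer s \<in> borel_measurable (generated (initial_past s n))"
    by (rule measurable_generated_mono[OF outer_measurable_generated past_subset(1)])
  with U(1) show "P.indep_pair (borel \<Otimes>\<^sub>M borel) (\<lambda>\<omega>. (U \<omega>, outer s \<omega>)) M (\<zeta> (Suc s) (Suc n))"
    by (intro indep_zeta measurable_Pair \<open>n < b\<close>)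
qed (use zeta_sample_Suc \<open>n < b\<close> in auto)

text \<open>The noises of different mini-batch samples at the common point \<open>outer s\<close>
  are orthogonal, so their second moments add up, and averaging divides the bound by
  \<open>b\<close>.\<close>

lemma err_0_second_moment:
  "(\<integral>\<omega>. (norm (err s 0 \<omega>))\<^sup>2 \<partial>P) \<le>
    ((2 * (L / \<mu>) - 1) * (\<integral>\<omega>. (norm (grad F (outer s \<omega>)))\<^sup>2 \<partial>P) + 2 * \<sigma>\<^sup>2) / real b"
proof -
  let ?N = "\<lambda>i \<omega>. noise (outer s \<omega>) (\<zeta> (Suc s) (Suc i) \<omega>)"
  define B where "B = (2 * (L / \<mu>) - 1) * (\<integral>\<omega>. (norm (grad F (outer s \<omega>)))\<^sup>2 \<partial>P) + 2 * \<sigma>\<^sup>2"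
  \<comment> \<open>Induction on the number of samples: the partial sum is determined by
    \<open>initial_past s n\<close>, hence orthogonal to the next noise term.\<close>
  have "(\<integral>\<omega>. (norm (\<Sum>i<n. ?N i \<omega>))\<^sup>2 \<partial>P) \<le> real n * B" if "n \<le> b" for n
    using that
  proof (induction n)
    case 0
    show ?case by simp
  next
    case (Suc n)
    then have n: "n < b" by simp
    have [measurable]: "outer s \<in> borel_measurable (generated (initial_past s n))"
      by (rule measurable_generated_mono[OF outer_measurable_generated past_subset(1)])
    have "?N i \<in> borel_measurable (generated (initial_past s n))" if "i < n" for i
    proof -
      have [measurable]: "\<zeta> (Suc s) (Suc i) \<in> measurable (generated (initial_past s n)) M"
        using that n by (intro zeta_measurable_generated) (auto simp: initial_past_def)
      show ?thesis by measurable
    qed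
    then have meas: "(\<lambda>\<omega>. \<Sum>i<n. ?N i \<omega>) \<in> borel_measurable (generated (initial_past s n))"
      by (intro borel_measurable_sum) auto
    have si: "square_integrable P (\<lambda>\<omega>. \<Sum>i<n. ?N i \<omega>)"
      using n by (intro P.square_integrable_sum zeta_noise_square_integrable) auto
    have "outer s \<in> borel_measurable (generated (initial_past s n))" by measurable
    from noise_compose_second_moment[OF P.prob_space_axioms outer_square_integrable indep_zeta[OF this n]]
    have "(\<integral>\<omega>. (norm (?N n \<omega>))\<^sup>2 \<partial>P) \<le> B"
      using zeta_sample_Suc[OF n] by (simp add: B_def)
    moreover have "(\<integral>\<omega>. (norm ((\<Sum>i<n. ?N i \<omega>) + ?N n \<omega>))\<^sup>2 \<partial>P) =
        (\<integral>\<omega>. (norm (\<Sum>i<n. ?N i \<omega>))\<^sup>2 \<partial>P) + (\<integral>\<omega>. (norm (?N n \<omega>))\<^sup>2 \<partial>P)"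
      by (intro integral_norm_add_orthogonal si zeta_noise_square_integrable n zeta_noise_orthogonal meas)
    ultimately show ?case
      using Suc by (simp add: distrib_right)
  qed
  from this[of b] have "(\<integral>\<omega>. (norm (\<Sum>i<b. ?N i \<omega>))\<^sup>2 \<partial>P) / (real b)\<^sup>2 \<le> B / real b"
    using b_pos by (simp add: field_simps power2_eq_square)
  moreover have "(\<integral>\<omega>. (norm (err s 0 \<omega>))\<^sup>2 \<partial>P) = (\<integral>\<omega>. (norm (\<Sum>i<b. ?N i \<omega>))\<^sup>2 \<partial>P) / (real b)\<^sup>2"
    by (simp add: err_0 power_divide)
  ultimately show ?thesis by (simp add: B_def)
qed

text \<open>\<open>v s 0\<close> is \<open>grad F\<close> plus the mini-batch error, an average of
  noises each orthogonal to the gradient at \<open>outer s\<close>.\<close>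

lemma v_0_second_moment:
  "(\<integral>\<omega>. (norm (v s 0 \<omega>))\<^sup>2 \<partial>P) =
    (\<integral>\<omega>. (norm (grad F (outer s \<omega>)))\<^sup>2 \<partial>P) + (\<integral>\<omega>. (norm (err s 0 \<omega>))\<^sup>2 \<partial>P)"
proof -
  have "(\<integral>\<omega>. inner (grad F (outer s \<omega>)) (noise (outer s \<omega>) (\<zeta> (Suc s) (Suc n) \<omega>)) \<partial>P) = 0"
    if "n < b" for n
  proof (rule zeta_noise_orthogonal[OF _ gradF_outer_square_integrable that])
    have [measurable]: "outer s \<in> borel_measurable (generated (initial_past s n))"
      by (rule measurable_generated_mono[OF outer_measurable_generated past_subset(1)])
    show "(\<lambda>\<omega>. grad F (outer s \<omega>)) \<in> borel_measurable (generated (initial_past s n))" by measurable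
  qed
  then have "(\<integral>\<omega>. inner (grad F (outer s \<omega>)) (err s 0 \<omega>) \<partial>P) = 0"
    by (simp add: err_0 inner_sum_right Bochner_Integration.integral_sum
        square_integrable_inner gradF_outer_square_integrable zeta_noise_square_integrable)
  from integral_norm_add_orthogonal[OF gradF_outer_square_integrable err_0_square_integrable this]
  show ?thesis by (simp add: err_def w_0)
qed

lemma xi_noise_orthogonal:
  assumes U: "U \<in> borel_measurable (generated (inner_past s t))" "square_integrable P U"
  shows "(\<integral>\<omega>. inner (U \<omega>) (noise (w s (Suc t) \<omega>) (\<xi> (Suc s) (Suc t) \<omega>)
    - noise (w s t \<omega>) (\<xi> (Suc s) (Suc t) \<omega>)) \<partial>P) = 0"
proof -
  have "(\<integral>\<omega>. inner (U \<omega>) (noise (w s t' \<omega>) (\<xi> (Suc s) (Suc t) \<omega>)) \<partial>P) = 0"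
    and "integrable P (\<lambda>\<omega>. inner (U \<omega>) (noise (w s t' \<omega>) (\<xi> (Suc s) (Suc t) \<omega>)))"
    if w: "w s t' \<in> borel_measurable (generated (inner_past s t))" for t'
  proof -
    have "P.indep_pair (borel \<Otimes>\<^sub>M borel) (\<lambda>\<omega>. (U \<omega>, w s t' \<omega>)) M (\<xi> (Suc s) (Suc t))"
      using U(1) w by (intro indep_xi measurable_Pair)
    from noise_orthogonal[OF P.prob_space_axioms w_square_integrable U(2) this w_measurable xi_sample_Suc]
    show "(\<integral>\<omega>. inner (U \<omega>) (noise (w s t' \<omega>) (\<xi> (Suc s) (Suc t) \<omega>)) \<partial>P) = 0" .
    show "integrable P (\<lambda>\<omega>. inner (U \<omega>) (noise (w s t' \<omega>) (\<xi> (Suc s) (Suc t) \<omega>)))"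
      by (intro square_integrable_inner U(2) noise_compose_square_integrable
          P.prob_space_axioms w_square_integrable w_measurable xi_sample_Suc)
  qed
  note orth = this
  note [measurable] = w_measurable_generated[of s t] v_measurable_generated[of s t]
  \<comment> \<open>The point \<open>w s (Suc t)\<close> depends only on \<open>w s t\<close> and
    \<open>v s t\<close>, so it too is fixed before the sample \<open>Suc t\<close> is
    drawn.\<close>
  have "w s (Suc t) \<in> borel_measurable (generated (inner_past s t))"
    unfolding w_Suc by measurable
  from orth[OF this] orth[OF w_measurable_generated] show ?thesis
    by (simp add: inner_diff_right)
qed

text \<open>The increment of \<open>v\<close> is \<open>D + N\<close>, with \<open>D\<close> the
  change of \<open>grad F\<close> and \<open>N\<close> the martingale increment of the error. As
  \<open>N\<close> is orthogonal to both \<open>D\<close> and \<open>err s t\<close>, its energy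
  adds to that of the error and is at most the energy of the increment of \<open>v\<close>.\<close>

lemma err_Suc_second_moment:
  "(\<integral>\<omega>. (norm (err s (Suc t) \<omega>))\<^sup>2 \<partial>P) \<le>
    (\<integral>\<omega>. (norm (err s t \<omega>))\<^sup>2 \<partial>P) + (\<integral>\<omega>. (norm (v s (Suc t) \<omega> - v s t \<omega>))\<^sup>2 \<partial>P)"
proof -
  define N where "N \<omega> = noise (w s (Suc t) \<omega>) (\<xi> (Suc s) (Suc t) \<omega>)
    - noise (w s t \<omega>) (\<xi> (Suc s) (Suc t) \<omega>)" for \<omega>
  define D where "D \<omega> = grad F (w s (Suc t) \<omega>) - grad F (w s t \<omega>)" for \<omega>
  have N_square_integrable: "square_integrable P N"
    unfolding N_def
    by (intro square_integrable_diff noise_compose_square_integrable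
        P.prob_space_axioms w_square_integrable w_measurable xi_sample_Suc)
  have D_square_integrable: "square_integrable P D"
    unfolding D_def by (intro square_integrable_diff gradF_w_square_integrable)
  note [measurable] = w_measurable_generated[of s t] v_measurable_generated[of s t]
  have D_meas: "D \<in> borel_measurable (generated (inner_past s t))"
    unfolding D_def w_Suc by measurable
  have "(\<integral>\<omega>. (norm (err s (Suc t) \<omega>))\<^sup>2 \<partial>P) =
      (\<integral>\<omega>. (norm (err s t \<omega>))\<^sup>2 \<partial>P) + (\<integral>\<omega>. (norm (N \<omega>))\<^sup>2 \<partial>P)"
    using integral_norm_add_orthogonal[OF err_square_integrable N_square_integrable]
      xi_noise_orthogonal[OF err_measurable_generated err_square_integrable, folded N_def]
    by (simp add: err_Suc N_def)
  also have "(\<integral>\<omega>. (norm (N \<omega>))\<^sup>2 \<partial>P) \<le> (\<integral>\<omega>. (norm (D \<omega>))\<^sup>2 \<partial>P) + (\<integral>\<omega>. (norm (N \<omega>))\<^sup>2 \<partial>P)"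
    by simp
  also have "\<dots> = (\<integral>\<omega>. (norm (D \<omega> + N \<omega>))\<^sup>2 \<partial>P)"
    using integral_norm_add_orthogonal[OF D_square_integrable N_square_integrable]
      xi_noise_orthogonal[OF D_meas D_square_integrable, folded N_def] by simp
  also have "\<dots> = (\<integral>\<omega>. (norm (v s (Suc t) \<omega> - v s t \<omega>))\<^sup>2 \<partial>P)"
    by (simp add: D_def N_def noise_def v_Suc)
  finally show ?thesis by simp
qed

lemma v_increment_second_moment:
  "(\<integral>\<omega>. (norm (v s (Suc t) \<omega> - v s t \<omega>))\<^sup>2 \<partial>P) \<le> \<eta> * L / (2 - \<eta> * L) *
    ((\<integral>\<omega>. (norm (v s t \<omega>))\<^sup>2 \<partial>P) - (\<integral>\<omega>. (norm (v s (Suc t) \<omega>))\<^sup>2 \<partial>P))"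
proof -
  have "(\<integral>\<omega>. (norm (v s (Suc t) \<omega> - v s t \<omega>))\<^sup>2 \<partial>P) \<le>
      (\<integral>\<omega>. \<eta> * L / (2 - \<eta> * L) * ((norm (v s t \<omega>))\<^sup>2 - (norm (v s (Suc t) \<omega>))\<^sup>2) \<partial>P)"
  proof (rule integral_mono)
    show "integrable P (\<lambda>\<omega>. (norm (v s (Suc t) \<omega> - v s t \<omega>))\<^sup>2)"
      by (intro square_integrableD(2) square_integrable_diff v_square_integrable)
    show "integrable P (\<lambda>\<omega>. \<eta> * L / (2 - \<eta> * L) * ((norm (v s t \<omega>))\<^sup>2 - (norm (v s (Suc t) \<omega>))\<^sup>2))"
      by (intro integrable_mult_right Bochner_Integration.integrable_diff square_integrableD(2) v_square_integrable)
    show "(norm (v s (Suc t) \<omega> - v s t \<omega>))\<^sup>2 \<le>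
        \<eta> * L / (2 - \<eta> * L) * ((norm (v s t \<omega>))\<^sup>2 - (norm (v s (Suc t) \<omega>))\<^sup>2)" if "\<omega> \<in> space P" for \<omega>
      using v_step_bound[OF that, of s t] eta_L by (simp add: pos_le_divide_eq mult.commute)
  qed
  then show ?thesis
    using square_integrableD(2)[OF v_square_integrable] by simp
qed

lemma err_second_moment:
  "(\<integral>\<omega>. (norm (err s t \<omega>))\<^sup>2 \<partial>P) \<le>
    (\<integral>\<omega>. (norm (err s 0 \<omega>))\<^sup>2 \<partial>P) + \<eta> * L / (2 - \<eta> * L) * (\<integral>\<omega>. (norm (v s 0 \<omega>))\<^sup>2 \<partial>P)"
proof -
  \<comment> \<open>Keeping the negative second moment of \<open>v s t\<close> makes the induction
    telescope; it is dropped only afterwards.\<close>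
  have "(\<integral>\<omega>. (norm (err s t \<omega>))\<^sup>2 \<partial>P) \<le> (\<integral>\<omega>. (norm (err s 0 \<omega>))\<^sup>2 \<partial>P) + \<eta> * L / (2 - \<eta> * L) *
      ((\<integral>\<omega>. (norm (v s 0 \<omega>))\<^sup>2 \<partial>P) - (\<integral>\<omega>. (norm (v s t \<omega>))\<^sup>2 \<partial>P))"
  proof (induction t)
    case (Suc t)
    then show ?case
      using err_Suc_second_moment[of t] v_increment_second_moment[of t]
      by (simp only: right_diff_distrib)
  qed simp
  also have "\<dots> \<le> (\<integral>\<omega>. (norm (err s 0 \<omega>))\<^sup>2 \<partial>P) +
      \<eta> * L / (2 - \<eta> * L) * (\<integral>\<omega>. (norm (v s 0 \<omega>))\<^sup>2 \<partial>P)"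
    using eta_L by (intro add_left_mono mult_left_mono) simp_all
  finally show ?thesis .
qed

text \<open>The descent lemma for one step, combined with the identity that the squared norm of
  \<open>v - g\<close> minus that of \<open>g\<close> equals the squared norm of \<open>v\<close>
  minus twice the inner product of \<open>g\<close> and \<open>v\<close>, where \<open>g\<close> is
  the gradient of \<open>F\<close>.\<close>

lemma gradF_w_second_moment:
  "(\<integral>\<omega>. (norm (grad F (w s t \<omega>)))\<^sup>2 \<partial>P) \<le>
    2 / \<eta> * ((\<integral>\<omega>. F (w s t \<omega>) \<partial>P) - (\<integral>\<omega>. F (w s (Suc t) \<omega>) \<partial>P)) + (\<integral>\<omega>. (norm (err s t \<omega>))\<^sup>2 \<partial>P)"
proof -
  have F_int: "integrable P (\<lambda>\<omega>. F (w s t \<omega>))" for t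
    by (rule F_integrable[OF P.prob_space_axioms w_square_integrable w_measurable])
  have "(norm (grad F (w s t \<omega>)))\<^sup>2 \<le> 2 / \<eta> * (F (w s t \<omega>) - F (w s (Suc t) \<omega>)) + (norm (err s t \<omega>))\<^sup>2"
    for \<omega>
  proof -
    let ?g = "grad F (w s t \<omega>)" and ?v = "v s t \<omega>"
    have "F (w s (Suc t) \<omega>) \<le> F (w s t \<omega>) - \<eta> * inner ?g ?v + L / 2 * (\<eta>\<^sup>2 * (norm ?v)\<^sup>2)"
      using L_smooth_upper_bound[OF F_smooth F_diff, of "w s (Suc t) \<omega>" "w s t \<omega>"]
      by (simp add: w_Suc power_mult_distrib)
    also have "L / 2 * (\<eta>\<^sup>2 * (norm ?v)\<^sup>2) = \<eta> / 2 * ((\<eta> * L) * (norm ?v)\<^sup>2)"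
      by (simp add: power2_eq_square)
    \<comment> \<open>The bound \<open>\<eta> * L \<le> 1\<close> leaves exactly the coefficient
      with which the square of the error is completed.\<close>
    also have "\<eta> / 2 * ((\<eta> * L) * (norm ?v)\<^sup>2) \<le> \<eta> / 2 * (1 * (norm ?v)\<^sup>2)"
      using eta_L eta_pos by (intro mult_left_mono mult_right_mono) auto
    finally have "2 / \<eta> * F (w s (Suc t) \<omega>) \<le>
        2 / \<eta> * (F (w s t \<omega>) - \<eta> * inner ?g ?v + \<eta> / 2 * (norm ?v)\<^sup>2)"
      using eta_pos by (intro mult_left_mono) auto
    also have "\<dots> = 2 / \<eta> * F (w s t \<omega>) - 2 * inner ?g ?v + (norm ?v)\<^sup>2"
      using eta_pos by (simp add: field_simps)
    finally show ?thesis
      by (simp add: err_def power2_norm_eq_inner inner_diff_left inner_diff_right inner_commute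
          right_diff_distrib)
  qed
  then have "(\<integral>\<omega>. (norm (grad F (w s t \<omega>)))\<^sup>2 \<partial>P) \<le>
      (\<integral>\<omega>. 2 / \<eta> * (F (w s t \<omega>) - F (w s (Suc t) \<omega>)) + (norm (err s t \<omega>))\<^sup>2 \<partial>P)"
    using F_int square_integrableD(2)[OF gradF_w_square_integrable] square_integrableD(2)[OF err_square_integrable]
    by (intro integral_mono) simp_all
  also have "\<dots> = 2 / \<eta> * ((\<integral>\<omega>. F (w s t \<omega>) \<partial>P) - (\<integral>\<omega>. F (w s (Suc t) \<omega>) \<partial>P))
      + (\<integral>\<omega>. (norm (err s t \<omega>))\<^sup>2 \<partial>P)"
    using F_int square_integrableD(2)[OF err_square_integrable] by simp
  finally show ?thesis .
qed

section \<open>The random output index and the contraction over one call\<close>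

lemma AE_T_le: "AE \<omega> in P. T (Suc s) \<omega> \<le> m"
proof -
  have "distr P (count_space UNIV) (T (Suc s)) = measure_pmf (pmf_of_set {0..m})"
    by (rule T_sample(2)) simp
  then have "AE k in distr P (count_space UNIV) (T (Suc s)). k \<le> m"
    by (simp only:) (simp add: AE_measure_pmf_iff)
  then show ?thesis
    by (subst (asm) AE_distr_iff) (simp_all add: T_sample)
qed

text \<open>Passes the assumption made on \<open>outer s\<close> on to the next call. Almost surely
  the output is one of finitely many iterates, so the sum over all of them dominates it.\<close>

lemma outer_Suc_square_integrable: "square_integrable P (\<lambda>\<omega>. outer (Suc s) \<omega> - w_star)"
proof -
  have "integrable P (\<lambda>\<omega>. (norm (outer (Suc s) \<omega> - w_star))\<^sup>2)"
  proof (rule Bochner_Integration.integrable_bound)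
    show "integrable P (\<lambda>\<omega>. \<Sum>t\<le>m. (norm (w s t \<omega> - w_star))\<^sup>2)"
      by (intro Bochner_Integration.integrable_sum square_integrableD(2) w_square_integrable)
    show "AE \<omega> in P. norm ((norm (outer (Suc s) \<omega> - w_star))\<^sup>2) \<le>
        norm (\<Sum>t\<le>m. (norm (w s t \<omega> - w_star))\<^sup>2)"
      using AE_T_le
    proof eventually_elim
      case (elim \<omega>)
      have "(norm (w s (T (Suc s) \<omega>) \<omega> - w_star))\<^sup>2 \<le> (\<Sum>t\<le>m. (norm (w s t \<omega> - w_star))\<^sup>2)"
        using elim by (intro member_le_sum) auto
      then show ?case by (simp add: outer_Suc)
    qed
  qed measurable
  then show ?thesis by (simp add: square_integrable_def)
qed

text \<open>Split according to the value of the index. Each event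
  \<open>T (Suc s) \<omega> = t\<close> is independent of \<open>w s t\<close> and has probability
  \<open>1 / (real m + 1)\<close>, so the output averages over the inner iterates.\<close>

lemma gradF_outer_Suc_second_moment:
  "(\<integral>\<omega>. (norm (grad F (outer (Suc s) \<omega>)))\<^sup>2 \<partial>P) =
    (\<Sum>t\<le>m. \<integral>\<omega>. (norm (grad F (w s t \<omega>)))\<^sup>2 \<partial>P) / (real m + 1)"
proof -
  have T[measurable]: "T (Suc s) \<in> measurable P (count_space UNIV)"
    by (simp add: T_sample)
  have Y: "integrable P (\<lambda>\<omega>. (norm (grad F (w s t \<omega>)))\<^sup>2)" for t
    by (rule square_integrableD(2)[OF gradF_w_square_integrable])
  have Yi: "integrable P (\<lambda>\<omega>. (norm (grad F (w s t \<omega>)))\<^sup>2 * indicator {t} (T (Suc s) \<omega>))" for t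
    by (rule Bochner_Integration.integrable_bound[OF Y[of t]])
      (auto simp: indicator_def)
  have eq: "(\<integral>\<omega>. (norm (grad F (w s t \<omega>)))\<^sup>2 * indicator {t} (T (Suc s) \<omega>) \<partial>P) =
      (\<integral>\<omega>. (norm (grad F (w s t \<omega>)))\<^sup>2 \<partial>P) / (real m + 1)" if "t \<le> m" for t
  proof -
    note [measurable] = w_measurable_generated[of s t]
    have "(\<lambda>\<omega>. (norm (grad F (w s t \<omega>)))\<^sup>2) \<in> borel_measurable (generated (inner_past s t))"
      by measurable
    note indep = indep_T[OF this]
    have "(\<lambda>p. fst p * indicator {t} (snd p) :: real) \<in> borel_measurable (borel \<Otimes>\<^sub>M count_space UNIV)"
      by (intro borel_measurable_times measurable_fst measurable_compose[OF measurable_snd]) simp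
    from P.integral_indep_pair(2)[OF indep this] Yi[of t]
    have "(\<integral>\<omega>. (norm (grad F (w s t \<omega>)))\<^sup>2 * indicator {t} (T (Suc s) \<omega>) \<partial>P) =
        (\<integral>\<omega>. (\<integral>k. (norm (grad F (w s t \<omega>)))\<^sup>2 * indicator {t} k \<partial>measure_pmf (pmf_of_set {0..m})) \<partial>P)"
      by (simp add: T_sample)
    also have "\<dots> = (\<integral>\<omega>. (norm (grad F (w s t \<omega>)))\<^sup>2 / (real m + 1) \<partial>P)"
      using that by (simp add: measure_pmf_single)
    finally show ?thesis by simp
  qed
  have "(\<integral>\<omega>. (norm (grad F (outer (Suc s) \<omega>)))\<^sup>2 \<partial>P) =
      (\<integral>\<omega>. (\<Sum>t\<le>m. (norm (grad F (w s t \<omega>)))\<^sup>2 * indicator {t} (T (Suc s) \<omega>)) \<partial>P)"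
  proof (rule integral_cong_AE)
    show "AE \<omega> in P. (norm (grad F (outer (Suc s) \<omega>)))\<^sup>2 =
        (\<Sum>t\<le>m. (norm (grad F (w s t \<omega>)))\<^sup>2 * indicator {t} (T (Suc s) \<omega>))"
      using AE_T_le
    proof eventually_elim
      case (elim \<omega>)
      have "(\<Sum>t\<le>m. (norm (grad F (w s t \<omega>)))\<^sup>2 * indicator {t} (T (Suc s) \<omega>)) =
          (\<Sum>t\<in>{T (Suc s) \<omega>}. (norm (grad F (w s t \<omega>)))\<^sup>2 * indicator {t} (T (Suc s) \<omega>))"
        using elim by (intro sum.mono_neutral_right) (auto simp: indicator_def)
      then show ?case by (simp add: outer_Suc)
    qed
    show "(\<lambda>\<omega>. \<Sum>t\<le>m. (norm (grad F (w s t \<omega>)))\<^sup>2 * indicator {t} (T (Suc s) \<omega>)) \<in> borel_measurable P"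
      by (intro borel_measurable_sum borel_measurable_integrable Yi)
  qed measurable
  also have "\<dots> = (\<Sum>t\<le>m. (\<integral>\<omega>. (norm (grad F (w s t \<omega>)))\<^sup>2 \<partial>P) / (real m + 1))"
    using Yi by (subst Bochner_Integration.integral_sum) (auto intro!: sum.cong eq)
  finally show ?thesis by (simp add: sum_divide_distrib)
qed

lemma outer_contraction:
  "(\<integral>\<omega>. (norm (grad F (outer (Suc s) \<omega>)))\<^sup>2 \<partial>P) \<le>
    (1 / (\<mu> * \<eta> * (real m + 1)) + \<eta> * L / (2 - \<eta> * L) + (4 * (L / \<mu>) - 2) / (real b * (2 - \<eta> * L)))
      * (\<integral>\<omega>. (norm (grad F (outer s \<omega>)))\<^sup>2 \<partial>P) + 4 / (real b * (2 - \<eta> * L)) * \<sigma>\<^sup>2"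
proof -
  define A where "A = (\<integral>\<omega>. (norm (grad F (outer s \<omega>)))\<^sup>2 \<partial>P)"
  define e where "e = (\<integral>\<omega>. (norm (err s 0 \<omega>))\<^sup>2 \<partial>P)"
  define \<theta> where "\<theta> = \<eta> * L / (2 - \<eta> * L)"
  define E where "E t = (\<integral>\<omega>. F (w s t \<omega>) \<partial>P)" for t
  have F_int: "integrable P (\<lambda>\<omega>. F (w s t \<omega>))" for t
    by (rule F_integrable[OF P.prob_space_axioms w_square_integrable w_measurable])
  \<comment> \<open>The telescoping sum over \<open>t \<le> m\<close> ends at \<open>Suc m\<close>,
    one step beyond the last possible output, where \<open>F\<close> is bounded below by its
    minimum.\<close>
  have "(\<integral>\<omega>. F w_star \<partial>P) \<le> E (Suc m)"
    unfolding E_def using F_int w_star_min by (intro integral_mono) simp_all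
  then have Em: "F w_star \<le> E (Suc m)" by (simp add: P.prob_space)
  have "(\<integral>\<omega>. F (w s 0 \<omega>) - F w_star \<partial>P) \<le> (\<integral>\<omega>. (norm (grad F (w s 0 \<omega>)))\<^sup>2 / (2 * \<mu>) \<partial>P)"
    using F_int F_gap_le square_integrableD(2)[OF gradF_w_square_integrable] by (intro integral_mono) simp_all
  then have E0: "E 0 - F w_star \<le> A / (2 * \<mu>)"
    using F_int[of 0] by (simp add: E_def A_def w_0 P.prob_space)
  \<comment> \<open>Here \<open>A + e\<close> is the second moment of \<open>v s 0\<close>, so the
    error bound no longer depends on \<open>t\<close>.\<close>
  have "(\<integral>\<omega>. (norm (grad F (w s t \<omega>)))\<^sup>2 \<partial>P) \<le> 2 / \<eta> * (E t - E (Suc t)) + (e + \<theta> * (A + e))" for t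
    using gradF_w_second_moment[of t] err_second_moment[of t] v_0_second_moment
    by (simp add: E_def A_def e_def \<theta>_def)
  then have "(\<Sum>t\<le>m. \<integral>\<omega>. (norm (grad F (w s t \<omega>)))\<^sup>2 \<partial>P) \<le>
      (\<Sum>t\<le>m. 2 / \<eta> * (E t - E (Suc t)) + (e + \<theta> * (A + e)))"
    by (intro sum_mono)
  also have "\<dots> = 2 / \<eta> * (E 0 - E (Suc m)) + (real m + 1) * (e + \<theta> * (A + e))"
    by (simp only: sum.distrib sum_distrib_left[symmetric] sum_telescope) (simp add: algebra_simps)
  also have "\<dots> \<le> 2 / \<eta> * (A / (2 * \<mu>)) + (real m + 1) * (e + \<theta> * (A + e))"
    using E0 Em eta_pos by (intro add_right_mono mult_left_mono) auto
  finally have "(\<integral>\<omega>. (norm (grad F (outer (Suc s) \<omega>)))\<^sup>2 \<partial>P) \<le>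
      (2 / \<eta> * (A / (2 * \<mu>)) + (real m + 1) * (e + \<theta> * (A + e))) / (real m + 1)"
    unfolding gradF_outer_Suc_second_moment by (intro divide_right_mono) auto
  also have "\<dots> = A / (\<mu> * \<eta> * (real m + 1)) + \<theta> * A + (1 + \<theta>) * e"
    using eta_pos mu_pos by (simp add: add_divide_distrib) (simp add: field_simps)
  \<comment> \<open>The initial error enters directly and again through \<open>v s 0\<close>;
    together the weights are \<open>1 + \<theta> = 2 / (2 - \<eta> * L)\<close>.\<close>
  also have "(1 + \<theta>) * e \<le> 2 / (2 - \<eta> * L) * (((2 * (L / \<mu>) - 1) * A + 2 * \<sigma>\<^sup>2) / real b)"
  proof -
    have "1 + \<theta> = 2 / (2 - \<eta> * L)" using eta_L by (simp add: \<theta>_def field_simps)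
    moreover have "e \<le> ((2 * (L / \<mu>) - 1) * A + 2 * \<sigma>\<^sup>2) / real b"
      using err_0_second_moment by (simp add: e_def A_def)
    ultimately show ?thesis using eta_L by (simp only:) (intro mult_left_mono, auto)
  qed
  also have "\<dots> = (4 * (L / \<mu>) - 2) / (real b * (2 - \<eta> * L)) * A + 4 / (real b * (2 - \<eta> * L)) * \<sigma>\<^sup>2"
  proof -
    have "2 / c * (((2 * k - 1) * A + S) / r) = (4 * k - 2) / (r * c) * A + 2 * S / (r * c)"
      if "c \<noteq> 0" "r \<noteq> 0" for c k r S :: real
      using that by (simp add: field_simps)
    from this[of "2 - \<eta> * L" "real b" "L / \<mu>" "2 * \<sigma>\<^sup>2"] show ?thesis
      using eta_L b_pos by simp
  qed
  finally show ?thesis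
    by (simp add: A_def[symmetric] \<theta>_def[symmetric] distrib_right)
qed

end

lemma outer_square_integrable: "square_integrable P (\<lambda>\<omega>. outer s \<omega> - w_star)"
  by (induction s) (simp_all add: P.square_integrable_const outer_Suc_square_integrable)

end

theorem theorem3:
  fixes M :: "'x measure"
    and P :: "'o measure"
    and f :: "real ^ 'd \<Rightarrow> 'x \<Rightarrow> real"
    and F :: "real ^ 'd \<Rightarrow> real"
    and w_star w0 :: "real ^ 'd"
    and L \<mu> \<sigma> \<eta> \<kappa> \<alpha> \<delta> \<Delta> :: real
    and m b :: nat
    and \<zeta> \<xi> :: "nat \<Rightarrow> nat \<Rightarrow> 'o \<Rightarrow> 'x"
    and T :: "nat \<Rightarrow> 'o \<Rightarrow> nat"
  assumes "prob_space M"
    and f_diff: "\<And>x w. x \<in> space M \<Longrightarrow> (\<lambda>u. f u x) differentiable at w"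
    and f_integrable: "\<And>w. integrable M (f w)"
    and F_def: "F = expected_loss M f"
    and F_bounded_below: "bdd_below (range F)"
    and F_diff: "\<And>w. F differentiable at w"
    and sgrad_integrable: "\<And>w. integrable M (sgrad f w)"
    and sgrad_unbiased: "\<And>w. (\<integral>x. sgrad f w x \<partial>M) = grad F w"
    and "L > 0"
    and f_convex: "\<And>x. x \<in> space M \<Longrightarrow> convex_on UNIV (\<lambda>u. f u x)"
    and f_smooth: "\<And>x. x \<in> space M \<Longrightarrow> L_smooth L (\<lambda>u. f u x)"
    and "\<mu> > 0"
    and F_strongly_convex: "strongly_convex \<mu> F"
    and w_star_min: "\<And>w. F w_star \<le> F w"
    and "\<sigma> > 0"
    and sigma_integrable: "integrable M (\<lambda>x. (norm (sgrad f w_star x))\<^sup>2)"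
    and sigma_bound: "(\<integral>x. (norm (sgrad f w_star x))\<^sup>2 \<partial>M) \<le> \<sigma>\<^sup>2"
    and "prob_space P"
    and "m > 0" and "b > 0"
    and sampling: "isarah_sampling P M m b \<zeta> \<xi> T"
    and "0 < \<eta>" and "\<eta> \<le> 1 / L"
    and kappa_def: "\<kappa> = L / \<mu>"
    and alpha_def: "\<alpha> = 1 / (\<mu> * \<eta> * (real m + 1)) + \<eta> * L / (2 - \<eta> * L)
                       + (4 * \<kappa> - 2) / (real b * (2 - \<eta> * L))"
    and "\<alpha> < 1"
    and delta_def: "\<delta> = 4 / (real b * (2 - \<eta> * L)) * \<sigma>\<^sup>2"
    and Delta_def: "\<Delta> = \<delta> / (1 - \<alpha>)"
  shows "\<forall>s\<ge>1.
    integrable P (\<lambda>\<omega>. (norm (grad F (isarah f \<eta> b w0 \<zeta> \<xi> T s \<omega>)))\<^sup>2) \<and>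
    (\<integral>\<omega>. (norm (grad F (isarah f \<eta> b w0 \<zeta> \<xi> T s \<omega>)))\<^sup>2 \<partial>P) - \<Delta>
      \<le> \<alpha> ^ s * ((norm (grad F w0))\<^sup>2 - \<Delta>)"
proof -
  interpret isarah_run M f F w_star L \<mu> \<sigma> P w0 \<eta> m b \<zeta> \<xi> T
    by (intro isarah_run.intro smooth_convex_objective.intro smooth_convex_objective_axioms.intro
        isarah_run_axioms.intro) (fact assms)+
  define E where "E s = (\<integral>\<omega>. (norm (grad F (outer s \<omega>)))\<^sup>2 \<partial>P)" for s
  \<comment> \<open>This makes \<open>4 * \<kappa> - 2\<close> positive, hence
    \<open>\<alpha>\<close> nonnegative, so that the induction hypothesis may be multiplied by
    \<open>\<alpha>\<close>.\<close>
  have "\<kappa> \<ge> 1"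
    using mu_le_L \<open>\<mu> > 0\<close> by (simp add: kappa_def)
  then have "\<alpha> \<ge> 0"
    using eta_L \<open>\<mu> > 0\<close> \<open>\<eta> > 0\<close> unfolding alpha_def by (intro add_nonneg_nonneg divide_nonneg_nonneg) auto
  \<comment> \<open>\<open>\<Delta>\<close> is the fixed point of the affine recursion; subtracting
    it leaves a purely geometric one.\<close>
  have fixed_point: "\<alpha> * \<Delta> + \<delta> = \<Delta>"
    using \<open>\<alpha> < 1\<close> by (simp add: Delta_def field_simps)
  have "E s - \<Delta> \<le> \<alpha> ^ s * ((norm (grad F w0))\<^sup>2 - \<Delta>)" for s
  proof (induction s)
    case 0
    show ?case by (simp add: E_def P.prob_space)
  next
    case (Suc s)
    have "E (Suc s) \<le> \<alpha> * E s + \<delta>"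
      using outer_contraction[OF outer_square_integrable, of s] unfolding E_def alpha_def delta_def kappa_def .
    then have "E (Suc s) - \<Delta> \<le> \<alpha> * (E s - \<Delta>)"
      using fixed_point by (simp add: right_diff_distrib)
    also have "\<dots> \<le> \<alpha> * (\<alpha> ^ s * ((norm (grad F w0))\<^sup>2 - \<Delta>))"
      using Suc \<open>\<alpha> \<ge> 0\<close> by (intro mult_left_mono)
    finally show ?case by (simp add: mult.assoc)
  qed
  moreover have "integrable P (\<lambda>\<omega>. (norm (grad F (outer s \<omega>)))\<^sup>2)" for s
    by (rule square_integrableD(2)[OF gradF_outer_square_integrable[OF outer_square_integrable]])
  ultimately show ?thesis by (simp add: E_def)
qed

end
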